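(* Let $X=\{X_1,\ldots,X_m\}$ be a family of linearly independent smooth vector fields on $\mathbb{R}^n$ satisfying (H.1) and (H.2) (see context). Let $\Omega\subseteq\mathbb{R}^n$ be a bounded connected open set, regular for the Divergence Theorem and $\delta_\lambda$-star shaped with respect to the origin (see context), and let $\mathcal{F}=\mathcal{F}(x,z,p):\Omega\times\mathbb{R}\times\mathbb{R}^m\to\mathbb{R}$ satisfy (P.1) and (P.2) (see context). Assume that: (i) $\mathcal{F}(x,0,p)-\langle\mathcal{F}_p(x,0,p),p\rangle\le0$ for all $x\in\partial\Omega$ and $p\in\mathbb{R}^m$; (ii) there exists $a_0\in\mathbb{R}$ such that $$q\,\mathcal{F}(x,z,p)-(a_0+1)\langle\mathcal{F}_p(x,z,p),p\rangle+\sum_{i=1}^n\sigma_ix_i\,\partial_{x_i}\mathcal{F}(x,z,p)-a_0\,z\,\partial_z\mathcal{F}(x,z,p)\ge0$$ for every $x\in\Omega$ and every $(z,p)\in\mathbb{R}\times\mathbb{R}^m$; (iii) either $z=0$ or $p=0$ whenever equality holds in the inequality of (ii) at $(x,z,p)$. Then the boundary-value problem $$\begin{cases}\mathrm{div}_X\big(\mathcal{F}_p(x,u(x),\nabla_Xu(x))\big)+\partial_z\mathcal{F}\big(x,u(x),\nabla_Xu(x)\big)=0&\text{in }\Omega,\\ u|_{\partial\Omega}=0\end{cases}$$ has no non-trivial solutions $u\in C^2(\overline\Omega)$; that is, every solution $u\in C^2(\overline\Omega)$ satisfies $u\equiv0$ in $\Omega$.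
   Context: Assumptions on the vector fields. $X_1,\ldots,X_m$ are smooth vector fields on $\mathbb{R}^n$, linearly independent (as elements of the real vector space of smooth vector fields), such that: (H.1) $X_1,\ldots,X_m$ are homogeneous of degree $1$ with respect to a family of dilations $\delta_\lambda(x)=(\lambda^{\sigma_1}x_1,\ldots,\lambda^{\sigma_n}x_n)$, $\lambda>0$, where $\sigma_1,\ldots,\sigma_n\in\mathbb{N}$ and $1=\sigma_1\le\cdots\le\sigma_n$; that is, $X_i(u\circ\delta_\lambda)=\lambda\,(X_iu)\circ\delta_\lambda$ for all $u\in C^\infty(\mathbb{R}^n)$, $\lambda>0$ and $i=1,\ldots,m$. (H.2) Hörmander's condition at $0$: $\dim\{Y(0):Y\in\mathrm{Lie}(X)\}=n$, where $\mathrm{Lie}(X)$ is the smallest Lie subalgebra of the smooth vector fields on $\mathbb{R}^n$ containing $X$, and $Y(0)\in\mathbb{R}^n$ is the coefficient vector of $Y$ at $0$. Notation. $q:=\sum_{k=1}^n\sigma_k$. $\mathrm{T}:=\sum_{i=1}^n\sigma_i x_i\partial_{x_i}$, so $\mathrm{T}(x)=(\sigma_1x_1,\ldots,\sigma_nx_n)$. $\nabla_Xu=(X_1u,\ldots,X_mu)$. For $V=(V_1,\ldots,V_m)$ of class $C^1$, $\mathrm{div}_XV:=-\sum_{i=1}^mX_iV_i$ (note the minus sign). $\mathcal{F}_p=(\partial_{p_1}\mathcal{F},\ldots,\partial_{p_m}\mathcal{F})$. "Regular for the Divergence Theorem" has its usual meaning: $H^{n-1}(\partial\Omega)<\infty$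 ($H^{n-1}$ being the $(n-1)$-dimensional Hausdorff measure), the outward unit normal $\nu$ is defined $H^{n-1}$-a.e. on $\partial\Omega$, and $\int_\Omega\mathrm{div}\,V\,dx=\int_{\partial\Omega}\langle V,\nu\rangle\,dH^{n-1}$ for all $V\in C^1(\overline\Omega;\mathbb{R}^n)$. A non-empty open set $\Omega\subseteq\mathbb{R}^n$ with $C^1$ boundary is called $\delta_\lambda$-star shaped (with respect to the origin) if $\langle\mathrm{T}(x),\nu\rangle\ge0$ for every $x\in\partial\Omega$, where $\nu$ is the outward unit normal to $\partial\Omega$ at $x$. Assumptions on $\mathcal{F}$, with $\mathcal{D}:=\Omega\times\mathbb{R}\times\mathbb{R}^m$: (P.1) $\mathcal{F}$ is of class $C^1$ on (an open neighborhood of) $\overline{\mathcal{D}}$; (P.2) for every $i=1,\ldots,m$, $\partial_{p_i}\mathcal{F}$ is of class $C^1$ on $\overline{\mathcal{D}}$. *)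

theory Defs
  imports "HOL-Analysis.Analysis"
begin

section \<open>Functions of class \<open>C\<^sup>k\<close>\<close>

definition partial_deriv :: "'a::euclidean_space \<Rightarrow> ('a \<Rightarrow> real) \<Rightarrow> 'a \<Rightarrow> real" where
  "partial_deriv b f x = frechet_derivative f (at x) b"

definition grad :: "('a::euclidean_space \<Rightarrow> real) \<Rightarrow> 'a \<Rightarrow> 'a" where
  "grad f x = (\<Sum>b\<in>Basis. partial_deriv b f x *\<^sub>R b)"

text \<open>Meaningful for open \<open>S\<close> only: \<open>partial_deriv\<close> takes two-sided derivatives.\<close>

primrec Ck_on :: "nat \<Rightarrow> ('a::euclidean_space \<Rightarrow> real) \<Rightarrow> 'a set \<Rightarrow> bool" where
  "Ck_on 0 f S \<longleftrightarrow> continuous_on S f"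
| "Ck_on (Suc k) f S \<longleftrightarrow>
     f differentiable_on S \<and> (\<forall>b\<in>Basis. Ck_on k (partial_deriv b f) S)"

definition smooth :: "('a::euclidean_space \<Rightarrow> real) \<Rightarrow> bool" where
  "smooth f \<longleftrightarrow> (\<forall>k. Ck_on k f UNIV)"

text \<open>
  Class \<open>C\<^sup>k\<close> on the closure of an open set \<open>S\<close>: \<open>f\<close> is continuous on the closure and of class
  \<open>C\<^sup>k\<close> in \<open>S\<close>, and all its partial derivatives of order at most \<open>k\<close> extend continuously from
  \<open>S\<close> to the closure. Nothing is required of \<open>f\<close> outside the closure.
\<close>

primrec Ck_closure :: "nat \<Rightarrow> ('a::euclidean_space \<Rightarrow> real) \<Rightarrow> 'a set \<Rightarrow> bool" where
  "Ck_closure 0 f S \<longleftrightarrow> continuous_on (closure S) f"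
| "Ck_closure (Suc k) f S \<longleftrightarrow>
     continuous_on (closure S) f \<and> f differentiable_on S \<and>
     (\<forall>b\<in>Basis. \<exists>g. (\<forall>x\<in>S. g x = partial_deriv b f x) \<and> Ck_closure k g S)"

section \<open>Vector fields\<close>

text \<open>
  A vector field is represented by its coefficient map; \<open>vf_apply Y\<close> is the corresponding
  first-order differential operator.
\<close>

type_synonym 'n vfield = "real^'n \<Rightarrow> real^'n"

definition smooth_vf :: "'n::finite vfield \<Rightarrow> bool" where
  "smooth_vf Y \<longleftrightarrow> (\<forall>j. smooth (\<lambda>x. Y x $ j))"

definition vf_apply :: "'n::finite vfield \<Rightarrow> (real^'n \<Rightarrow> real) \<Rightarrow> real^'n \<Rightarrow> real" where
  "vf_apply Y u x = (\<Sum>j\<in>UNIV. Y x $ j * partial_deriv (axis j 1) u x)"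

definition lie_bracket :: "'n::finite vfield \<Rightarrow> 'n vfield \<Rightarrow> 'n vfield" where
  "lie_bracket Y Z = (\<lambda>x. \<chi> k. vf_apply Y (\<lambda>y. Z y $ k) x - vf_apply Z (\<lambda>y. Y y $ k) x)"

definition lie_subalgebra :: "'n::finite vfield set \<Rightarrow> bool" where
  "lie_subalgebra L \<longleftrightarrow>
     L \<subseteq> Collect smooth_vf \<and> (\<lambda>x. 0) \<in> L \<and>
     (\<forall>Y\<in>L. \<forall>Z\<in>L. (\<lambda>x. Y x + Z x) \<in> L) \<and>
     (\<forall>c. \<forall>Y\<in>L. (\<lambda>x. c *\<^sub>R Y x) \<in> L) \<and>
     (\<forall>Y\<in>L. \<forall>Z\<in>L. lie_bracket Y Z \<in> L)"

definition Lie :: "('m \<Rightarrow> 'n::finite vfield) \<Rightarrow> 'n vfield set" where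
  "Lie X = lie_subalgebra hull range X"

definition vf_independent :: "('m::finite \<Rightarrow> 'n::finite vfield) \<Rightarrow> bool" where
  "vf_independent X \<longleftrightarrow>
     (\<forall>c :: 'm \<Rightarrow> real. (\<forall>x. (\<Sum>i\<in>UNIV. c i *\<^sub>R X i x) = 0) \<longrightarrow> (\<forall>i. c i = 0))"

definition dilation :: "('n \<Rightarrow> nat) \<Rightarrow> real \<Rightarrow> real^'n \<Rightarrow> real^'n" where
  "dilation \<sigma> r x = (\<chi> j. r ^ \<sigma> j * x $ j)"

definition homogeneous_deg1 :: "('n \<Rightarrow> nat) \<Rightarrow> 'n::finite vfield \<Rightarrow> bool" where
  "homogeneous_deg1 \<sigma> Y \<longleftrightarrow>
     (\<forall>u r x. smooth u \<longrightarrow> 0 < r \<longrightarrow>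
        vf_apply Y (u \<circ> dilation \<sigma> r) x = r * vf_apply Y u (dilation \<sigma> r x))"

definition T_field :: "('n \<Rightarrow> nat) \<Rightarrow> real^'n \<Rightarrow> real^'n" where
  "T_field \<sigma> x = (\<chi> i. real (\<sigma> i) * x $ i)"

definition grad_X :: "('m \<Rightarrow> 'n::finite vfield) \<Rightarrow> (real^'n \<Rightarrow> real) \<Rightarrow> real^'n \<Rightarrow> real^'m" where
  "grad_X X u x = (\<chi> i. vf_apply (X i) u x)"

definition div_X :: "('m::finite \<Rightarrow> 'n::finite vfield) \<Rightarrow> (real^'n \<Rightarrow> real^'m) \<Rightarrow> real^'n \<Rightarrow> real" where
  "div_X X V x = - (\<Sum>i\<in>UNIV. vf_apply (X i) (\<lambda>y. V y $ i) x)"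

section \<open>Hausdorff measure\<close>

text \<open>
  The \<open>k\<close>-dimensional Hausdorff measure with the usual normalisation, in which a covering set
  contributes the volume of the \<open>k\<close>-dimensional ball with the same diameter. Empty covering sets
  must not contribute, also for \<open>k = 0\<close> (where \<open>0 ^ 0 = 1\<close>), and \<open>diameter\<close> is meaningful only on
  bounded sets.
\<close>

definition hausdorff_content :: "nat \<Rightarrow> real \<Rightarrow> 'a::metric_space set \<Rightarrow> ennreal" where
  "hausdorff_content k \<delta> A =
     (INF C \<in> {C :: nat \<Rightarrow> 'a set. A \<subseteq> (\<Union>i. C i) \<and> (\<forall>i. bounded (C i) \<and> diameter (C i) \<le> \<delta>)}.
        \<Sum>i. if C i = {} then 0 else ennreal (unit_ball_vol (real k) * (diameter (C i) / 2) ^ k))"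

definition hausdorff_outer :: "nat \<Rightarrow> 'a::metric_space set \<Rightarrow> ennreal" where
  "hausdorff_outer k A = (SUP \<delta>\<in>{0<..}. hausdorff_content k \<delta> A)"

definition hausdorff_measure :: "nat \<Rightarrow> 'a::metric_space measure" where
  "hausdorff_measure k =
     measure_of UNIV (lambda_system UNIV UNIV (hausdorff_outer k)) (hausdorff_outer k)"

lemma hausdorff_content_subadditive:
  fixes A :: "nat \<Rightarrow> 'a::metric_space set"
  shows "hausdorff_content k \<delta> (\<Union>i. A i) \<le> (\<Sum>i. hausdorff_content k \<delta> (A i))"
proof (rule ennreal_le_epsilon)
  fix e :: real
  assume e: "0 < e" and fin: "(\<Sum>i. hausdorff_content k \<delta> (A i)) < top"
  define w where "w = (\<lambda>S::'a set. if S = {} then 0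
                        else ennreal (unit_ball_vol (real k) * (diameter S / 2) ^ k))"
  define Cov where "Cov = (\<lambda>B. {C :: nat \<Rightarrow> 'a set. B \<subseteq> (\<Union>i. C i) \<and>
                                  (\<forall>i. bounded (C i) \<and> diameter (C i) \<le> \<delta>)})"
  have hc: "hausdorff_content k \<delta> B = (INF C\<in>Cov B. \<Sum>i. w (C i))" for B
    by (simp add: hausdorff_content_def w_def Cov_def)
  have "hausdorff_content k \<delta> (A n) < hausdorff_content k \<delta> (A n) + e * (1/2)^Suc n" for n
    using e fin by (auto simp add: less_top dest!: ennreal_suminf_lessD)
  then have "\<exists>C\<in>Cov (A n). (\<Sum>i. w (C i)) \<le> hausdorff_content k \<delta> (A n) + e * (1/2)^Suc n" for n
    unfolding hc INF_less_iff using less_imp_le by blast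
  then obtain C where C: "\<And>n. C n \<in> Cov (A n)"
      "\<And>n. (\<Sum>i. w (C n i)) \<le> hausdorff_content k \<delta> (A n) + e * (1/2)^Suc n"
    by metis
  define D where "D = case_prod C \<circ> prod_decode"
  have "x \<in> (\<Union>j. D j)" if x: "x \<in> A n" for x n
  proof -
    obtain i where "x \<in> C n i"
      using C(1)[of n] x by (auto simp: Cov_def)
    then have "x \<in> D (prod_encode (n, i))"
      by (simp add: D_def)
    then show ?thesis by blast
  qed
  then have "D \<in> Cov (\<Union>i. A i)"
    using C(1) by (auto simp: D_def Cov_def split: prod.splits)
  then have "hausdorff_content k \<delta> (\<Union>i. A i) \<le> (\<Sum>j. w (D j))"
    unfolding hc by (rule INF_lower)
  also have "\<dots> = (\<Sum>j. ((\<lambda>(n, i). w (C n i)) \<circ> prod_decode) j)"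
    by (simp add: D_def case_prod_beta)
  also have "\<dots> = (\<Sum>n. \<Sum>i. w (C n i))"
    unfolding comp_def by (rule suminf_ennreal_2dimen[unfolded comp_def]) simp
  also have "\<dots> \<le> (\<Sum>n. hausdorff_content k \<delta> (A n) + e * (1/2)^Suc n)"
    by (intro suminf_le C(2) summableI)
  also have "\<dots> = (\<Sum>n. hausdorff_content k \<delta> (A n)) + (\<Sum>n. ennreal e * ennreal ((1/2) ^ Suc n))"
    using e by (subst suminf_add[symmetric])
               (auto simp del: ennreal_suminf_cmult simp add: ennreal_mult[symmetric])
  also have "\<dots> = (\<Sum>n. hausdorff_content k \<delta> (A n)) + e"
    unfolding ennreal_suminf_cmult
    by (subst suminf_ennreal_eq[OF zero_le_power power_half_series]) auto
  finally show "hausdorff_content k \<delta> (\<Union>i. A i) \<le> (\<Sum>i. hausdorff_content k \<delta> (A i)) + e" .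
qed

lemma outer_measure_space_hausdorff: "outer_measure_space UNIV (hausdorff_outer k :: 'a::metric_space set \<Rightarrow> ennreal)"
  (is "outer_measure_space UNIV ?H")
proof -
  have "hausdorff_content k \<delta> ({} :: 'a set) = 0" if "0 < \<delta>" for \<delta>
  proof -
    have "hausdorff_content k \<delta> ({} :: 'a set) \<le> (\<Sum>i::nat. 0)"
      unfolding hausdorff_content_def using that
      by (intro INF_lower2[of "\<lambda>_. {}"]) (auto simp: diameter_def)
    then show ?thesis by simp
  qed
  then have "?H {} \<le> 0"
    unfolding hausdorff_outer_def by (intro SUP_least) simp
  then have "?H {} = 0" by simp
  moreover have "hausdorff_content k \<delta> A \<le> hausdorff_content k \<delta> B" if "A \<subseteq> B" for \<delta> and A B :: "'a set"
    unfolding hausdorff_content_def using that by (intro INF_superset_mono) auto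
  then have "increasing UNIV ?H"
    unfolding increasing_def hausdorff_outer_def by (auto intro!: SUP_mono)
  moreover have "?H (\<Union>i. A i) \<le> (\<Sum>i. ?H (A i))" for A
    unfolding hausdorff_outer_def
  proof (rule SUP_least)
    fix \<delta> :: real
    assume "\<delta> \<in> {0<..}"
    then show "hausdorff_content k \<delta> (\<Union>i. A i)
                 \<le> (\<Sum>i. SUP \<delta>\<in>{0<..}. hausdorff_content k \<delta> (A i))"
      by (intro order_trans[OF hausdorff_content_subadditive] suminf_le SUP_upper summableI)
  qed
  ultimately show ?thesis
    by (simp add: outer_measure_space_def positive_def countably_subadditive_def)
qed

lemma measure_space_hausdorff:
  "measure_space UNIV (lambda_system UNIV UNIV (hausdorff_outer k)) (hausdorff_outer k)"
  by (rule sigma_algebra.caratheodory_lemma[OF sigma_algebra_Pow[of UNIV], unfolded Pow_UNIV])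
     (rule outer_measure_space_hausdorff)

lemma space_hausdorff_measure: "space (hausdorff_measure k) = UNIV"
  by (simp add: hausdorff_measure_def space_measure_of)

lemma sets_hausdorff_measure:
  "sets (hausdorff_measure k :: 'a::metric_space measure) = lambda_system UNIV UNIV (hausdorff_outer k)"
proof -
  have "sigma_algebra UNIV (lambda_system UNIV UNIV (hausdorff_outer k :: 'a set \<Rightarrow> ennreal))"
    using measure_space_hausdorff by (auto simp: measure_space_def)
  then show ?thesis
    by (simp add: hausdorff_measure_def sigma_algebra.sigma_sets_eq)
qed

lemma emeasure_hausdorff_measure:
  fixes A :: "'a::metric_space set"
  assumes "A \<in> sets (hausdorff_measure k)"
  shows "emeasure (hausdorff_measure k) A = hausdorff_outer k A"
  using assms measure_space_hausdorff[where ?'a = 'a and k = k]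
  unfolding sets_hausdorff_measure unfolding hausdorff_measure_def measure_space_def
  by (intro emeasure_measure_of_sigma) auto

section \<open>Boundary, outward normal, Divergence Theorem\<close>

definition C1_boundary :: "(real^'n) set \<Rightarrow> bool" where
  "C1_boundary \<Omega> \<longleftrightarrow>
     (\<forall>x\<in>frontier \<Omega>. \<exists>U \<phi>. open U \<and> x \<in> U \<and> Ck_on 1 \<phi> U \<and> (\<forall>y\<in>U. grad \<phi> y \<noteq> 0) \<and>
        \<Omega> \<inter> U = {y\<in>U. \<phi> y < 0})"

text \<open>
  The outward unit normal at a single boundary point only needs a local defining function that is
  differentiable, with nonzero gradient, at that point.
\<close>

definition outward_unit_normal :: "(real^'n) set \<Rightarrow> real^'n \<Rightarrow> real^'n \<Rightarrow> bool" where
  "outward_unit_normal \<Omega> x \<nu> \<longleftrightarrow>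
     x \<in> frontier \<Omega> \<and>
     (\<exists>U \<phi>. open U \<and> x \<in> U \<and> \<phi> x = 0 \<and> \<phi> differentiable (at x) \<and> grad \<phi> x \<noteq> 0 \<and>
        \<Omega> \<inter> U = {y\<in>U. \<phi> y < 0} \<and> \<nu> = grad \<phi> x /\<^sub>R norm (grad \<phi> x))"

definition divergence :: "(real^'n \<Rightarrow> real^'n) \<Rightarrow> real^'n \<Rightarrow> real" where
  "divergence V x = (\<Sum>j\<in>UNIV. partial_deriv (axis j 1) (\<lambda>y. V y $ j) x)"

definition regular_for_divergence_theorem :: "(real^'n) set \<Rightarrow> bool" where
  "regular_for_divergence_theorem \<Omega> \<longleftrightarrow>
     hausdorff_outer (CARD('n) - 1) (frontier \<Omega>) < \<infinity> \<and>
     (\<exists>\<nu> :: real^'n \<Rightarrow> real^'n.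
        (AE x in hausdorff_measure (CARD('n) - 1).
           x \<in> frontier \<Omega> \<longrightarrow> outward_unit_normal \<Omega> x (\<nu> x)) \<and>
        (\<forall>V :: real^'n \<Rightarrow> real^'n. (\<forall>j. Ck_closure 1 (\<lambda>x. V x $ j) \<Omega>) \<longrightarrow>
           set_integrable (hausdorff_measure (CARD('n) - 1)) (frontier \<Omega>) (\<lambda>x. V x \<bullet> \<nu> x) \<and>
           (LINT x:\<Omega>|lborel. divergence V x) =
           (LINT x:frontier \<Omega>|hausdorff_measure (CARD('n) - 1). V x \<bullet> \<nu> x)))"

definition star_shaped :: "('n \<Rightarrow> nat) \<Rightarrow> (real^'n) set \<Rightarrow> bool" where
  "star_shaped \<sigma> \<Omega> \<longleftrightarrow>
     open \<Omega> \<and> \<Omega> \<noteq> {} \<and> C1_boundary \<Omega> \<and>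
     (\<forall>x\<in>frontier \<Omega>. \<forall>\<nu>. outward_unit_normal \<Omega> x \<nu> \<longrightarrow> 0 \<le> T_field \<sigma> x \<bullet> \<nu>)"

section \<open>Partial derivatives of \<open>F(x, z, p)\<close>\<close>

definition D_x :: "'n::finite \<Rightarrow> ((real^'n) \<times> real \<times> (real^'m) \<Rightarrow> real) \<Rightarrow> (real^'n) \<times> real \<times> (real^'m) \<Rightarrow> real" where
  "D_x i F = partial_deriv (axis i 1, 0, 0) F"

definition D_z :: "((real^'n) \<times> real \<times> (real^'m) \<Rightarrow> real) \<Rightarrow> (real^'n) \<times> real \<times> (real^'m) \<Rightarrow> real" where
  "D_z F = partial_deriv (0, 1, 0) F"

definition D_p :: "((real^'n) \<times> real \<times> (real^'m) \<Rightarrow> real) \<Rightarrow> (real^'n) \<times> real \<times> (real^'m) \<Rightarrow> real^'m" where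
  "D_p F w = (\<chi> i. partial_deriv (0, 0, axis i 1) F w)"

definition structure_expr ::
  "('n::finite \<Rightarrow> nat) \<Rightarrow> real \<Rightarrow> ((real^'n) \<times> real \<times> (real^'m) \<Rightarrow> real) \<Rightarrow>
    real^'n \<Rightarrow> real \<Rightarrow> real^'m \<Rightarrow> real" where
  "structure_expr \<sigma> a\<^sub>0 F x z p =
     real (\<Sum>k\<in>UNIV. \<sigma> k) * F (x, z, p) - (a\<^sub>0 + 1) * (D_p F (x, z, p) \<bullet> p)
     + (\<Sum>i\<in>UNIV. real (\<sigma> i) * x $ i * D_x i F (x, z, p)) - a\<^sub>0 * z * D_z F (x, z, p)"

end

theory Submission
  imports Defs
begin

text \<open>
  The proof is a Pohozaev argument. For a solution \<open>u\<close> consider the vector field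
  \<open>V = F T - (T u + a\<^sub>0 u) \<Sum>\<^sub>i F\<^bsub>p\<^sub>i\<^esub> X\<^sub>i\<close>, where \<open>F\<close> and \<open>F\<^sub>p\<close> are evaluated at \<open>(x, u, \<nabla>\<^sub>X u)\<close>.
  Homogeneity makes each \<open>X\<^sub>i\<close> divergence free and gives the commutator relation
  \<open>[X\<^sub>i, T] = X\<^sub>i\<close>. With these, and with the equation, all second derivatives of \<open>u\<close> cancel in
  \<open>div V\<close>, which becomes the expression of hypothesis (ii) (\<open>pohozaev_identity\<close>); hence
  \<open>div V \<ge> 0\<close> in \<open>\<Omega>\<close>.

  On the boundary \<open>u\<close> vanishes, so its gradient is a multiple of the outward normal
  (\<open>boundary_gradient_normal\<close>). Therefore \<open>\<langle>V, \<nu>\<rangle> = \<langle>T, \<nu>\<rangle> (F - \<langle>F\<^sub>p, \<nabla>\<^sub>X u\<rangle>)\<close>, which is \<open>\<le> 0\<close> by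
  star-shapedness and (i). The Divergence Theorem then forces \<open>div V = 0\<close> throughout \<open>\<Omega>\<close>, and (iii)
  says that at every point \<open>u = 0\<close> or \<open>\<nabla>\<^sub>X u = 0\<close>.

  Consequently \<open>X\<^sub>i (u\<^sup>2) = 2 u X\<^sub>i u = 0\<close> for all \<open>i\<close>. The smooth fields that annihilate a fixed
  \<open>C\<^sup>2\<close> function form a Lie algebra (\<open>Lie_annihilates\<close>), so all of \<open>Lie X\<close> annihilates \<open>u\<^sup>2\<close>.
  Hoermander's condition at \<open>0\<close> persists near \<open>0\<close>, and dilations carry it to every point
  (\<open>homogeneous_family_annihilates_imp_grad_0\<close>). Hence \<open>u\<^sup>2\<close> has zero gradient in the connected set
  \<open>\<Omega>\<close>, is constant there, and vanishes because it vanishes on the boundary.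
\<close>

section \<open>Gradients\<close>

lemma GDERIV_unique:
  assumes "GDERIV f x :> g" and "GDERIV f x :> g'"
  shows "g = g'"
proof -
  have "(\<lambda>h. h \<bullet> g) = (\<lambda>h. h \<bullet> g')"
    using assms unfolding gderiv_def by (rule has_derivative_unique)
  then show ?thesis
    by (metis vector_eq_ldot)
qed

lemma partial_deriv_GDERIV:
  assumes "GDERIV f x :> g"
  shows "partial_deriv b f x = b \<bullet> g"
  using frechet_derivative_at[of f "\<lambda>h. h \<bullet> g" x] assms
  by (metis gderiv_def partial_deriv_def)

lemma GDERIV_grad:
  assumes "f differentiable (at x)"
  shows "GDERIV f x :> grad f x"
proof -
  let ?D = "frechet_derivative f (at x)"
  have D: "(f has_derivative ?D) (at x)"
    using assms frechet_derivative_works by blast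
  then have lin: "linear ?D"
    by (rule has_derivative_linear)
  have "?D h = h \<bullet> grad f x" for h
  proof -
    have "?D h = ?D (\<Sum>b\<in>Basis. (h \<bullet> b) *\<^sub>R b)"
      by (simp add: euclidean_representation)
    also have "\<dots> = (\<Sum>b\<in>Basis. (h \<bullet> b) * ?D b)"
      by (simp add: linear_sum[OF lin] linear_cmul[OF lin])
    also have "\<dots> = h \<bullet> grad f x"
      by (simp add: grad_def partial_deriv_def inner_sum_right mult.commute)
    finally show ?thesis .
  qed
  then have "?D = (\<lambda>h. h \<bullet> grad f x)" by blast
  with D show ?thesis
    by (simp add: gderiv_def)
qed

lemma vf_apply_GDERIV:
  assumes "GDERIV f x :> g"
  shows "vf_apply Y f x = Y x \<bullet> g"
  by (simp add: vf_apply_def partial_deriv_GDERIV[OF assms] inner_axis_axis inner_axis' inner_vec_def[of "Y x"])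

lemma GDERIV_transform_open:
  assumes "GDERIV f x :> g" and "open S" and "x \<in> S" and "\<And>y. y \<in> S \<Longrightarrow> f y = h y"
  shows "GDERIV h x :> g"
  using assms unfolding gderiv_def by (metis has_derivative_transform_within_open)

lemma GDERIV_sum:
  assumes "\<And>i. i \<in> I \<Longrightarrow> GDERIV (f i) x :> g i"
  shows "GDERIV (\<lambda>x. \<Sum>i\<in>I. f i x) x :> (\<Sum>i\<in>I. g i)"
  using assms unfolding gderiv_def inner_sum_right by (intro has_derivative_sum) auto

lemma GDERIV_component: "GDERIV (\<lambda>x::real^'n. x $ j) x :> axis j 1"
  unfolding gderiv_def inner_axis
  by (simp add: bounded_linear_imp_has_derivative bounded_linear_vec_nth)

lemma has_derivative_vecI:
  fixes g :: "'a::real_normed_vector \<Rightarrow> real^'n"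
  assumes "\<And>j. ((\<lambda>x. g x $ j) has_derivative (\<lambda>h. d j h)) (at x)"
  shows "(g has_derivative (\<lambda>h. \<chi> j. d j h)) (at x)"
  unfolding has_derivative_componentwise_within[of g] Basis_vec_def
  using assms by (auto simp: inner_axis)

text \<open>
  The mean value theorem along a segment whose end points may lie on the boundary of the region
  where the function is differentiable.
\<close>

lemma GDERIV_mvt_segment:
  fixes f :: "'a::euclidean_space \<Rightarrow> real"
  assumes cont: "continuous_on (closed_segment a b) f"
    and der: "\<And>y. y \<in> open_segment a b \<Longrightarrow> GDERIV f y :> g y"
    and "a \<noteq> b"
  obtains y where "y \<in> open_segment a b" "f b - f a = (b - a) \<bullet> g y"
proof -
  let ?c = "\<lambda>t::real. a + t *\<^sub>R (b - a)"
  have in_open: "?c t \<in> open_segment a b" if "0 < t" "t < 1" for t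
    using that \<open>a \<noteq> b\<close> by (auto simp: in_segment algebra_simps intro!: exI[of _ t])
  have "?c ` {0..1} \<subseteq> closed_segment a b"
    by (auto simp: in_segment algebra_simps intro!: exI[of _ "_::real"])
  then have c: "continuous_on {0..1} (\<lambda>t. f (?c t))"
    by (intro continuous_on_compose2[OF cont] continuous_intros) auto
  have d: "((\<lambda>t. f (?c t)) has_derivative (\<lambda>s. (s *\<^sub>R (b - a)) \<bullet> g (?c t))) (at t)"
    if "0 < t" "t < 1" for t
    using der[OF in_open[OF that]] unfolding gderiv_def
    by (intro has_derivative_compose[of ?c _ _ UNIV f, simplified]) (auto intro!: derivative_eq_intros)
  obtain t where "0 < t" "t < 1" "f (?c 1) - f (?c 0) = ((1 - 0) *\<^sub>R (b - a)) \<bullet> g (?c t)"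
    by (rule mvt[OF _ c d]) auto
  then show ?thesis
    using that[OF in_open[of t]] by simp
qed

subsection \<open>Symmetry of the second derivative\<close>

text \<open>
  The second difference of \<open>f\<close> along \<open>h\<close> and \<open>k\<close>, divided by \<open>t\<^sup>2\<close>, tends to the derivative of the
  gradient along \<open>k\<close>, paired with \<open>h\<close>. The second difference does not change when \<open>h\<close> and \<open>k\<close> are
  exchanged, hence neither does the limit.
\<close>

lemma second_difference_estimate:
  fixes f :: "'a::euclidean_space \<Rightarrow> real"
  assumes "open S" "x \<in> S" and f: "\<forall>y\<in>S. GDERIV f y :> g y"
    and g: "(g has_derivative H) (at x)" and "0 < e"
  shows "\<forall>\<^sub>F t in at_right 0.
    \<bar>(f (x + t *\<^sub>R h + t *\<^sub>R k) - f (x + t *\<^sub>R h) - f (x + t *\<^sub>R k) + f x) - t\<^sup>2 * (h \<bullet> H k)\<bar>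
      \<le> t\<^sup>2 * (e * (2 * norm h * (norm h + norm k)))"
proof -
  have lin: "linear H" using g by (rule has_derivative_linear)
  obtain d0 where d0: "0 < d0" "\<And>y. norm (y - x) < d0 \<Longrightarrow> y \<in> S"
    using \<open>open S\<close> \<open>x \<in> S\<close> by (metis dist_norm open_dist)
  obtain d1 where d1: "0 < d1"
    "\<And>y. norm (y - x) < d1 \<Longrightarrow> norm (g y - g x - H (y - x)) \<le> e * norm (y - x)"
    using g \<open>0 < e\<close> unfolding has_derivative_at_alt by blast
  define N where "N = norm h + norm k"
  define d where "d = min d0 d1 / (N + 1)"
  have "0 < d" using d0(1) d1(1) by (simp add: d_def N_def add_nonneg_pos)
  have *: "\<bar>(f (x + t *\<^sub>R h + t *\<^sub>R k) - f (x + t *\<^sub>R h) - f (x + t *\<^sub>R k) + f x) - t\<^sup>2 * (h \<bullet> H k)\<bar>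
      \<le> t\<^sup>2 * (e * (2 * norm h * N))" if t: "0 < t" "t < d" for t
  proof -
    have tN: "t * N < min d0 d1"
    proof -
      have "t * N \<le> t * (N + 1)" using t by simp
      also have "\<dots> < d * (N + 1)" using t by (simp add: N_def add_nonneg_pos)
      also have "\<dots> = min d0 d1" 
        using add_nonneg_pos[of N 1] by (simp add: d_def N_def)
      finally show ?thesis .
    qed
    have bound: "norm (s *\<^sub>R h + r *\<^sub>R k) \<le> t * N" if "0 \<le> s" "s \<le> t" "0 \<le> r" "r \<le> t" for s r
    proof -
      have "norm (s *\<^sub>R h + r *\<^sub>R k) \<le> s * norm h + r * norm k"
        using norm_triangle_ineq[of "s *\<^sub>R h" "r *\<^sub>R k"] that by simp
      also have "\<dots> \<le> t * N" using that by (simp add: N_def distrib_left add_mono mult_right_mono)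
      finally show ?thesis .
    qed
    have inS: "x + (s *\<^sub>R h + r *\<^sub>R k) \<in> S" if "0 \<le> s" "s \<le> t" "0 \<le> r" "r \<le> t" for s r
      using bound[OF that] tN d0(2)[of "x + (s *\<^sub>R h + r *\<^sub>R k)"] by simp
    let ?q = "\<lambda>s. f (x + (s *\<^sub>R h + t *\<^sub>R k)) - f (x + (s *\<^sub>R h + 0 *\<^sub>R k))"
    have der: "((\<lambda>s. f (x + (s *\<^sub>R h + r *\<^sub>R k))) has_derivative
        (\<lambda>a. (a *\<^sub>R h) \<bullet> g (x + (s *\<^sub>R h + r *\<^sub>R k)))) (at s)"
      if "0 \<le> s" "s \<le> t" "0 \<le> r" "r \<le> t" for s r
      using bspec[OF f inS[OF that]] unfolding gderiv_def
      by (intro has_derivative_compose[of "\<lambda>s. x + (s *\<^sub>R h + r *\<^sub>R k)" _ _ UNIV f, simplified])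
         (auto intro!: derivative_eq_intros)
    have derq: "(?q has_derivative (\<lambda>a. (a *\<^sub>R h) \<bullet> g (x + (s *\<^sub>R h + t *\<^sub>R k))
        - (a *\<^sub>R h) \<bullet> g (x + (s *\<^sub>R h + 0 *\<^sub>R k)))) (at s)" if "0 \<le> s" "s \<le> t" for s
      using that t by (intro has_derivative_diff der) auto
    obtain s where s: "0 < s" "s < t" and q: "?q t - ?q 0 =
        ((t - 0) *\<^sub>R h) \<bullet> g (x + (s *\<^sub>R h + t *\<^sub>R k)) - ((t - 0) *\<^sub>R h) \<bullet> g (x + (s *\<^sub>R h + 0 *\<^sub>R k))"
    proof (rule mvt[of 0 t ?q "\<lambda>s a. (a *\<^sub>R h) \<bullet> g (x + (s *\<^sub>R h + t *\<^sub>R k))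
        - (a *\<^sub>R h) \<bullet> g (x + (s *\<^sub>R h + 0 *\<^sub>R k))"])
      show "continuous_on {0..t} ?q"
        by (intro continuous_at_imp_continuous_on ballI has_derivative_continuous[OF derq]) auto
      show "(?q has_derivative (\<lambda>a. (a *\<^sub>R h) \<bullet> g (x + (s *\<^sub>R h + t *\<^sub>R k))
        - (a *\<^sub>R h) \<bullet> g (x + (s *\<^sub>R h + 0 *\<^sub>R k)))) (at s)" if "0 < s" "s < t" for s
        using that by (intro derq) auto
    qed (use t in auto)
    let ?E = "\<lambda>r. g (x + (s *\<^sub>R h + r *\<^sub>R k)) - g x - H (s *\<^sub>R h + r *\<^sub>R k)"
    have E: "norm (?E r) \<le> e * (t * N)" if "0 \<le> r" "r \<le> t" for r
    proof -
      have le: "norm (s *\<^sub>R h + r *\<^sub>R k) \<le> t * N"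
        using s that by (intro bound) auto
      then have "norm (?E r) \<le> e * norm (s *\<^sub>R h + r *\<^sub>R k)"
        using d1(2)[of "x + (s *\<^sub>R h + r *\<^sub>R k)"] tN by simp
      also have "\<dots> \<le> e * (t * N)" using le \<open>0 < e\<close> by simp
      finally show ?thesis .
    qed
    have "?E t - ?E 0 = g (x + (s *\<^sub>R h + t *\<^sub>R k)) - g (x + (s *\<^sub>R h + 0 *\<^sub>R k)) - t *\<^sub>R H k"
      by (simp add: linear_add[OF lin] linear_cmul[OF lin])
    then have "h \<bullet> (?E t - ?E 0) = h \<bullet> g (x + (s *\<^sub>R h + t *\<^sub>R k)) - h \<bullet> g (x + (s *\<^sub>R h + 0 *\<^sub>R k)) - t * (h \<bullet> H k)"
      by (simp only: inner_diff_right inner_scaleR_right)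
    moreover have "?q t - ?q 0 - t\<^sup>2 * (h \<bullet> H k) = t * (h \<bullet> g (x + (s *\<^sub>R h + t *\<^sub>R k))
        - h \<bullet> g (x + (s *\<^sub>R h + 0 *\<^sub>R k)) - t * (h \<bullet> H k))"
      unfolding q by (simp add: algebra_simps power2_eq_square)
    ultimately have eq: "?q t - ?q 0 - t\<^sup>2 * (h \<bullet> H k) = t * (h \<bullet> (?E t - ?E 0))"
      by presburger
    have "\<bar>h \<bullet> (?E t - ?E 0)\<bar> \<le> norm h * norm (?E t - ?E 0)"
      by (rule Cauchy_Schwarz_ineq2)
    also have "\<dots> \<le> norm h * (e * (t * N) + e * (t * N))"
      using t by (intro mult_left_mono order_trans[OF norm_triangle_ineq4 add_mono[OF E E]]) auto
    finally have "t * \<bar>h \<bullet> (?E t - ?E 0)\<bar> \<le> t * (norm h * (e * (t * N) + e * (t * N)))"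
      using t by (intro mult_left_mono) auto
    also have "\<dots> = t\<^sup>2 * (e * (2 * norm h * N))"
      by (simp add: power2_eq_square algebra_simps)
    finally have "\<bar>?q t - ?q 0 - t\<^sup>2 * (h \<bullet> H k)\<bar> \<le> t\<^sup>2 * (e * (2 * norm h * N))"
      unfolding eq using t by (simp add: abs_mult)
    moreover have "?q t - ?q 0 = f (x + t *\<^sub>R h + t *\<^sub>R k) - f (x + t *\<^sub>R h) - f (x + t *\<^sub>R k) + f x"
      by (simp add: add.assoc)
    ultimately show ?thesis by simp
  qed
  then show ?thesis
    unfolding eventually_at_right_field N_def using \<open>0 < d\<close> by blast
qed

lemma second_derivative_symmetric:
  fixes f :: "'a::euclidean_space \<Rightarrow> real"
  assumes "open S" "x \<in> S" and f: "\<forall>y\<in>S. GDERIV f y :> g y"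
    and g: "(g has_derivative H) (at x)"
  shows "h \<bullet> H k = k \<bullet> H h"
proof -
  define C where "C = 2 * norm h * (norm h + norm k) + 2 * norm k * (norm k + norm h)"
  have "0 \<le> C" by (simp add: C_def)
  have le: "\<bar>h \<bullet> H k - k \<bullet> H h\<bar> \<le> e * C" if "0 < e" for e
  proof -
    have "\<forall>\<^sub>F t::real in at_right 0. \<bar>h \<bullet> H k - k \<bullet> H h\<bar> \<le> e * C"
      using second_difference_estimate[OF assms(1,2) f g that, of h k]
        second_difference_estimate[OF assms(1,2) f g that, of k h] eventually_at_right_less[of 0]
    proof eventually_elim
      case (elim t)
      let ?D = "f (x + t *\<^sub>R h + t *\<^sub>R k) - f (x + t *\<^sub>R h) - f (x + t *\<^sub>R k) + f x"
      have "f (x + t *\<^sub>R k + t *\<^sub>R h) - f (x + t *\<^sub>R k) - f (x + t *\<^sub>R h) + f x = ?D"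
        by (simp add: algebra_simps)
      with elim(1,2) have "\<bar>t\<^sup>2 * (h \<bullet> H k) - t\<^sup>2 * (k \<bullet> H h)\<bar>
          \<le> t\<^sup>2 * (e * (2 * norm h * (norm h + norm k))) + t\<^sup>2 * (e * (2 * norm k * (norm k + norm h)))"
        by linarith
      also have "t\<^sup>2 * (h \<bullet> H k) - t\<^sup>2 * (k \<bullet> H h) = t\<^sup>2 * (h \<bullet> H k - k \<bullet> H h)"
        by (simp add: right_diff_distrib)
      finally have "t\<^sup>2 * \<bar>h \<bullet> H k - k \<bullet> H h\<bar> \<le> t\<^sup>2 * (e * C)"
        by (simp only: C_def abs_mult abs_power2 distrib_left)
      then show ?case using elim(3) by simp
    qed
    then show ?thesis by simp
  qed
  have "\<bar>h \<bullet> H k - k \<bullet> H h\<bar> \<le> 0"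
  proof (rule field_le_epsilon)
    fix e :: real assume "0 < e"
    then have "\<bar>h \<bullet> H k - k \<bullet> H h\<bar> \<le> e / (C + 1) * C"
      using \<open>0 \<le> C\<close> by (intro le) simp
    also have "\<dots> \<le> e" using \<open>0 \<le> C\<close> \<open>0 < e\<close> by (simp add: field_simps)
    finally show "\<bar>h \<bullet> H k - k \<bullet> H h\<bar> \<le> 0 + e" by simp
  qed
  then show ?thesis by simp
qed

section \<open>Smooth functions and vector fields\<close>

lemma Ck_on_const: "Ck_on k (\<lambda>x::'a::euclidean_space. c) UNIV"
proof (induction k arbitrary: c)
  case (Suc k)
  have "partial_deriv b (\<lambda>x. c) = (\<lambda>x. 0)" for b :: 'a
    using partial_deriv_GDERIV[OF GDERIV_const] by fastforce
  moreover have "(\<lambda>x. c) differentiable_on (UNIV :: 'a set)"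
    by simp
  ultimately show ?case using Suc[of 0] by (metis Ck_on.simps(2))
qed simp

lemma Ck_on_Suc_imp: "Ck_on (Suc k) f S \<Longrightarrow> Ck_on k f S"
proof (induction k arbitrary: f)
  case 0
  then show ?case by (simp add: differentiable_imp_continuous_on)
qed simp

lemma Ck_on_GDERIV:
  assumes "Ck_on (Suc k) f UNIV"
  shows "GDERIV f x :> grad f x"
  using assms by (intro GDERIV_grad) (auto simp: differentiable_on_def)

lemma Ck_on_SucI:
  assumes "\<And>x. GDERIV f x :> g x" and "\<And>b. b \<in> Basis \<Longrightarrow> Ck_on k (\<lambda>x. b \<bullet> g x) UNIV"
  shows "Ck_on (Suc k) f UNIV"
proof -
  have "f differentiable_on UNIV"
    using assms(1) unfolding gderiv_def differentiable_on_def differentiable_def by blast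
  moreover have "partial_deriv b f = (\<lambda>x. b \<bullet> g x)" for b
    using partial_deriv_GDERIV[OF assms(1)] by blast
  ultimately show ?thesis using assms(2) by (metis Ck_on.simps(2))
qed

lemma Ck_on_partial:
  assumes "Ck_on (Suc k) f UNIV" "b \<in> Basis"
  shows "Ck_on k (\<lambda>x. b \<bullet> grad f x) UNIV"
proof -
  have "partial_deriv b f = (\<lambda>x. b \<bullet> grad f x)"
    using partial_deriv_GDERIV[OF Ck_on_GDERIV[OF assms(1)]] by blast
  with assms show ?thesis by (metis Ck_on.simps(2))
qed

lemma Ck_on_add:
  assumes "Ck_on k f UNIV" "Ck_on k g UNIV"
  shows "Ck_on k (\<lambda>x. f x + g x) UNIV"
  using assms
proof (induction k arbitrary: f g)
  case 0
  then show ?case by (simp add: continuous_on_add)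
next
  case (Suc k)
  show ?case
  proof (rule Ck_on_SucI[of _ "\<lambda>x. grad f x + grad g x"])
    show "Ck_on k (\<lambda>x. b \<bullet> (grad f x + grad g x)) UNIV" if "b \<in> Basis" for b
      unfolding inner_add_right by (intro Suc.IH Ck_on_partial Suc.prems that)
  qed (intro GDERIV_add Ck_on_GDERIV[OF Suc.prems(1)] Ck_on_GDERIV[OF Suc.prems(2)])
qed

lemma Ck_on_mult:
  assumes "Ck_on k f UNIV" "Ck_on k g UNIV"
  shows "Ck_on k (\<lambda>x. f x * g x) UNIV"
  using assms
proof (induction k arbitrary: f g)
  case 0
  then show ?case by (simp add: continuous_on_mult)
next
  case (Suc k)
  show ?case
  proof (rule Ck_on_SucI[of _ "\<lambda>x. f x *\<^sub>R grad g x + g x *\<^sub>R grad f x"])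
    show "Ck_on k (\<lambda>x. b \<bullet> (f x *\<^sub>R grad g x + g x *\<^sub>R grad f x)) UNIV" if "b \<in> Basis" for b
      unfolding inner_add_right inner_scaleR_right
      by (intro Ck_on_add Suc.IH Ck_on_partial Ck_on_Suc_imp[OF Suc.prems(1)]
          Ck_on_Suc_imp[OF Suc.prems(2)] Suc.prems that)
  qed (intro GDERIV_mult Ck_on_GDERIV[OF Suc.prems(1)] Ck_on_GDERIV[OF Suc.prems(2)])
qed

lemma smooth_const: "smooth (\<lambda>x. c)"
  by (simp add: smooth_def Ck_on_const)

lemma smooth_add: "smooth f \<Longrightarrow> smooth g \<Longrightarrow> smooth (\<lambda>x. f x + g x)"
  by (simp add: smooth_def Ck_on_add)

lemma smooth_mult: "smooth f \<Longrightarrow> smooth g \<Longrightarrow> smooth (\<lambda>x. f x * g x)"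
  by (simp add: smooth_def Ck_on_mult)

lemma smooth_diff: "smooth f \<Longrightarrow> smooth g \<Longrightarrow> smooth (\<lambda>x. f x - g x)"
  using smooth_add[of f "\<lambda>x. -1 * g x"] smooth_mult[OF smooth_const[of "-1"], of g] by simp

lemma smooth_sum: "(\<And>i. i \<in> I \<Longrightarrow> smooth (f i)) \<Longrightarrow> smooth (\<lambda>x. \<Sum>i\<in>I. f i x)"
  by (induction I rule: infinite_finite_induct) (auto simp: smooth_const smooth_add)

lemma smooth_partial_deriv: "smooth f \<Longrightarrow> b \<in> Basis \<Longrightarrow> smooth (partial_deriv b f)"
  unfolding smooth_def by (metis Ck_on.simps(2))

lemma smooth_GDERIV: "smooth f \<Longrightarrow> GDERIV f x :> grad f x"
  unfolding smooth_def by (blast intro: Ck_on_GDERIV)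

lemma continuous_on_grad:
  assumes "Ck_on 1 f S"
  shows "continuous_on S (grad f)"
  using assms unfolding grad_def[abs_def] by (auto intro!: continuous_intros)

lemma smooth_continuous_grad: "smooth f \<Longrightarrow> continuous_on UNIV (grad f)"
  by (simp add: smooth_def continuous_on_grad del: Ck_on.simps)

lemma smooth_component: "smooth (\<lambda>x::real^'n. x $ j)"
proof -
  have "Ck_on (Suc k) (\<lambda>x::real^'n. x $ j) UNIV" for k
    by (rule Ck_on_SucI[of _ "\<lambda>x. axis j 1"]) (auto simp: GDERIV_component Ck_on_const)
  then show ?thesis
    unfolding smooth_def using Ck_on_Suc_imp by blast
qed

text \<open>The differential of a vector field at \<open>x\<close>, applied to the direction \<open>h\<close>.\<close>

definition vf_deriv :: "'n::finite vfield \<Rightarrow> real^'n \<Rightarrow> real^'n \<Rightarrow> real^'n" where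
  "vf_deriv Y x h = (\<chi> k. h \<bullet> grad (\<lambda>y. Y y $ k) x)"

lemma smooth_vf_has_derivative:
  assumes "smooth_vf Y"
  shows "(Y has_derivative vf_deriv Y x) (at x)"
  using assms smooth_GDERIV unfolding smooth_vf_def gderiv_def vf_deriv_def[abs_def]
  by (intro has_derivative_vecI) blast

lemma smooth_vf_continuous: "smooth_vf Y \<Longrightarrow> continuous_on S Y"
  by (meson continuous_at_imp_continuous_on has_derivative_continuous smooth_vf_has_derivative)

lemma lie_bracket_eq:
  assumes "smooth_vf Y" "smooth_vf Z"
  shows "lie_bracket Y Z x = vf_deriv Z x (Y x) - vf_deriv Y x (Z x)"
proof -
  have "vf_apply A (\<lambda>y. B y $ k) x = vf_deriv B x (A x) $ k" if "smooth_vf B" for A B k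
    using that vf_apply_GDERIV[OF smooth_GDERIV, of "\<lambda>y. B y $ k" A x]
    by (simp add: smooth_vf_def vf_deriv_def)
  with assms show ?thesis
    by (simp add: lie_bracket_def vec_eq_iff)
qed

lemma smooth_vf_lie_bracket:
  assumes "smooth_vf Y" "smooth_vf Z"
  shows "smooth_vf (lie_bracket Y Z)"
  using assms unfolding smooth_vf_def lie_bracket_def vf_apply_def
  by (auto intro!: smooth_diff smooth_sum smooth_mult smooth_partial_deriv simp: axis_in_Basis_iff)

lemma lie_subalgebra_smooth: "lie_subalgebra (Collect smooth_vf)"
  unfolding lie_subalgebra_def using smooth_vf_lie_bracket
  by (auto simp: smooth_vf_def intro!: smooth_add smooth_mult smooth_const)

lemma lie_subalgebra_Lie:
  assumes "\<forall>i. smooth_vf (X i)"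
  shows "lie_subalgebra (Lie X)"
proof -
  have "range X \<subseteq> Collect smooth_vf" using assms by auto
  then have "Lie X \<subseteq> Collect smooth_vf"
    unfolding Lie_def by (intro hull_minimal lie_subalgebra_smooth)
  moreover have "(\<lambda>x. 0) \<in> Lie X \<and>
     (\<forall>Y\<in>Lie X. \<forall>Z\<in>Lie X. (\<lambda>x. Y x + Z x) \<in> Lie X) \<and>
     (\<forall>c. \<forall>Y\<in>Lie X. (\<lambda>x. c *\<^sub>R Y x) \<in> Lie X) \<and>
     (\<forall>Y\<in>Lie X. \<forall>Z\<in>Lie X. lie_bracket Y Z \<in> Lie X)"
    unfolding Lie_def hull_def lie_subalgebra_def by blast
  ultimately show ?thesis unfolding lie_subalgebra_def by blast
qed

section \<open>Functions annihilated by a Hoermander family\<close>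

text \<open>
  If two smooth fields annihilate \<open>w\<close> in an open set, so does their bracket. It is enough that
  \<open>w\<close> be twice differentiable, because \<open>w\<close> itself is the same at every step of the generation of
  the Lie algebra: iterated brackets never require higher derivatives of \<open>w\<close>.
\<close>

lemma Lie_annihilates:
  fixes w :: "real^'n \<Rightarrow> real" and X :: "'m \<Rightarrow> 'n::finite vfield"
  assumes "open S" and w: "\<forall>y\<in>S. GDERIV w y :> g y"
    and g: "\<And>y. y \<in> S \<Longrightarrow> (g has_derivative H y) (at y)"
    and X: "\<forall>i. smooth_vf (X i)" "\<And>i y. y \<in> S \<Longrightarrow> X i y \<bullet> g y = 0"
    and "Y \<in> Lie X" "y \<in> S"
  shows "Y y \<bullet> g y = 0"
proof -
  define L where "L = {Y. smooth_vf Y \<and> (\<forall>y\<in>S. Y y \<bullet> g y = 0)}"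
  have deriv: "vf_deriv Y y h \<bullet> g y = - (Y y \<bullet> H y h)" if "Y \<in> L" "y \<in> S" for Y y h
  proof -
    have "((\<lambda>y. Y y \<bullet> g y) has_derivative (\<lambda>h. Y y \<bullet> H y h + vf_deriv Y y h \<bullet> g y)) (at y)"
      using that g by (intro has_derivative_inner smooth_vf_has_derivative) (auto simp: L_def)
    moreover have "((\<lambda>y. Y y \<bullet> g y) has_derivative (\<lambda>h. 0)) (at y)"
      by (rule has_derivative_transform_within_open[OF has_derivative_const \<open>open S\<close> \<open>y \<in> S\<close>])
        (use that in \<open>simp add: L_def\<close>)
    ultimately have "(\<lambda>h. Y y \<bullet> H y h + vf_deriv Y y h \<bullet> g y) = (\<lambda>h. 0)"
      by (rule has_derivative_unique)
    then have "Y y \<bullet> H y h + vf_deriv Y y h \<bullet> g y = 0"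
      by (rule fun_cong)
    then show ?thesis by linarith
  qed
  have "lie_bracket Y Z \<in> L" if YZ: "Y \<in> L" "Z \<in> L" for Y Z
  proof -
    have sm: "smooth_vf Y" "smooth_vf Z" using YZ by (auto simp: L_def)
    have "lie_bracket Y Z y \<bullet> g y = 0" if y: "y \<in> S" for y
      using deriv[OF YZ(1) y] deriv[OF YZ(2) y]
        second_derivative_symmetric[OF \<open>open S\<close> y w g[OF y], of "Y y" "Z y"]
      by (simp add: lie_bracket_eq[OF sm] inner_diff_left)
    then show ?thesis
      by (simp add: L_def smooth_vf_lie_bracket[OF sm])
  qed
  moreover have "(\<lambda>x. 0) \<in> L"
    by (simp add: L_def smooth_vf_def smooth_const)
  moreover have "(\<lambda>x. Y x + Z x) \<in> L" if "Y \<in> L" "Z \<in> L" for Y Z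
    using that by (simp add: L_def smooth_vf_def smooth_add inner_add_left)
  moreover have "(\<lambda>x. c *\<^sub>R Y x) \<in> L" if "Y \<in> L" for c Y
    using that by (simp add: L_def smooth_vf_def smooth_mult smooth_const)
  moreover have "L \<subseteq> Collect smooth_vf"
    by (auto simp: L_def)
  ultimately have "lie_subalgebra L"
    unfolding lie_subalgebra_def by blast
  moreover have "range X \<subseteq> L" using X by (auto simp: L_def)
  ultimately have "Lie X \<subseteq> L"
    unfolding Lie_def by (simp add: hull_minimal)
  then show ?thesis using assms(6,7) by (auto simp: L_def)
qed

text \<open>The spanning condition is open: if it holds at the origin, it holds near the origin.\<close>

lemma Lie_spans_near_0:
  fixes X :: "'m \<Rightarrow> 'n::finite vfield"
  assumes X: "\<forall>i. smooth_vf (X i)" and H2: "dim {Y 0 | Y. Y \<in> Lie X} = CARD('n)"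
  shows "\<forall>\<^sub>F y in nhds 0. \<forall>g. (\<forall>Y\<in>Lie X. Y y \<bullet> g = 0) \<longrightarrow> g = 0"
proof -
  let ?V = "{Y 0 | Y. Y \<in> Lie X}"
  have L: "\<And>Y. Y \<in> Lie X \<Longrightarrow> smooth_vf Y" "(\<lambda>x. 0) \<in> Lie X"
    "\<And>Y Z. Y \<in> Lie X \<Longrightarrow> Z \<in> Lie X \<Longrightarrow> (\<lambda>x. Y x + Z x) \<in> Lie X"
    "\<And>c Y. Y \<in> Lie X \<Longrightarrow> (\<lambda>x. c *\<^sub>R Y x) \<in> Lie X"
    using lie_subalgebra_Lie[OF X] unfolding lie_subalgebra_def by blast+
  have "subspace ?V"
  proof (rule subspaceI)
    show "0 \<in> ?V"
      using L(2) by (intro CollectI exI[of _ "\<lambda>x. 0"] conjI) (rule refl)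
    show "x + y \<in> ?V" if "x \<in> ?V" "y \<in> ?V" for x y
    proof -
      from that obtain Y Z where "x = Y 0" "y = Z 0" "Y \<in> Lie X" "Z \<in> Lie X" by blast
      then show ?thesis
        by (intro CollectI exI[of _ "\<lambda>x. Y x + Z x"] conjI L(3)) simp_all
    qed
    show "c *\<^sub>R x \<in> ?V" if "x \<in> ?V" for c x
    proof -
      from that obtain Y where "x = Y 0" "Y \<in> Lie X" by blast
      then show ?thesis
        by (intro CollectI exI[of _ "\<lambda>x. c *\<^sub>R Y x"] conjI L(4)) simp_all
    qed
  qed
  then have "span ?V = ?V" by (rule span_eq_iff[THEN iffD2])
  moreover have "span ?V = UNIV"
    using H2 dim_eq_full[of ?V] by simp
  ultimately have "?V = UNIV" by (rule trans[OF sym])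
  then have "\<exists>Y. Y \<in> Lie X \<and> Y 0 = b" for b
  proof -
    have "b \<in> ?V" using \<open>?V = UNIV\<close> by simp
    then show ?thesis by blast
  qed
  then obtain Y where Y: "\<And>b. Y b \<in> Lie X" "\<And>b. Y b 0 = b" by metis
  \<comment> \<open>orthogonality to vectors within \<open>c\<close> of the basis forces \<open>g = 0\<close>: the \<open>CARD('n)\<close> errors \<open>c\<close> add up to \<open>1/2\<close>\<close>
  define c where "c = 1 / (2 * real (CARD('n)))"
  have "0 < c" by (simp add: c_def)
  have "\<forall>\<^sub>F y in nhds 0. dist (Y b y) b < c" for b
  proof -
    have "smooth_vf (Y b)" by (rule L(1)[OF Y(1)])
    then have "isCont (Y b) 0"
      using smooth_vf_continuous[of "Y b" UNIV] by (simp add: continuous_on_eq_continuous_at)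
    then have "(Y b \<longlongrightarrow> b) (nhds 0)"
      using tendsto_nhds_iff[of "Y b" b 0] Y(2)[of b] by (simp add: isCont_def)
    then show ?thesis using \<open>0 < c\<close> by (rule tendstoD)
  qed
  then have "\<forall>\<^sub>F y in nhds 0. \<forall>b\<in>Basis. dist (Y b y) b < c"
    by (simp add: eventually_ball_finite)
  then show ?thesis
  proof eventually_elim
    case (elim y)
    have "g = 0" if g: "\<forall>Y\<in>Lie X. Y y \<bullet> g = 0" for g
    proof -
      have "\<bar>g \<bullet> b\<bar> \<le> norm g * c" if "b \<in> Basis" for b
      proof -
        have "g \<bullet> b = g \<bullet> (b - Y b y)"
          using g Y(1)[of b] by (simp add: inner_diff_right inner_commute)
        also have "\<bar>\<dots>\<bar> \<le> norm g * norm (b - Y b y)" by (rule Cauchy_Schwarz_ineq2)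
        also have "\<dots> \<le> norm g * c"
          using bspec[OF elim that] by (intro mult_left_mono) (simp_all add: dist_norm norm_minus_commute)
        finally show ?thesis .
      qed
      then have "(\<Sum>b\<in>Basis. \<bar>g \<bullet> b\<bar>) \<le> (\<Sum>b\<in>(Basis::(real^'n) set). norm g * c)"
        by (rule sum_mono)
      also have "\<dots> = norm g / 2" by (simp add: c_def)
      finally have "norm g \<le> norm g / 2" using norm_le_l1[of g] by linarith
      then show ?thesis by simp
    qed
    then show ?case by blast
  qed
qed

section \<open>Dilations and homogeneous vector fields\<close>

lemma dilation_nth [simp]: "dilation \<sigma> r x $ j = r ^ \<sigma> j * x $ j"
  by (simp add: dilation_def)

lemma linear_dilation: "linear (dilation \<sigma> r :: real^'n \<Rightarrow> real^'n)"
  by (rule linearI) (simp_all add: vec_eq_iff algebra_simps)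

lemma dilation_inner: "dilation \<sigma> r x \<bullet> y = x \<bullet> dilation \<sigma> r y"
  by (simp add: inner_vec_def mult_ac)

lemma dilation_axis: "dilation \<sigma> r (axis j 1) = r ^ \<sigma> j *\<^sub>R axis j 1"
  by (simp add: vec_eq_iff axis_def)

lemma dilation_inverse:
  assumes "r \<noteq> 0"
  shows "dilation \<sigma> (1 / r) (dilation \<sigma> r x) = x"
  using assms by (simp add: vec_eq_iff power_one_over)

lemma dilation_has_derivative: "(dilation \<sigma> r has_derivative dilation \<sigma> r) (at (x::real^'n))"
  by (intro bounded_linear_imp_has_derivative linear_conv_bounded_linear[THEN iffD1] linear_dilation)

lemma dilation_tendsto_0:
  assumes "\<And>j. 1 \<le> \<sigma> j"
  shows "((\<lambda>r. dilation \<sigma> r (x::real^'n)) \<longlongrightarrow> 0) (at_right 0)"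
proof (rule vec_tendstoI)
  fix j
  have "((\<lambda>r::real. r ^ \<sigma> j * x $ j) \<longlongrightarrow> 0 ^ \<sigma> j * x $ j) (at_right 0)"
    by (intro tendsto_intros)
  moreover have "(0::real) ^ \<sigma> j = 0" using assms[of j] by simp
  ultimately show "((\<lambda>r. dilation \<sigma> r x $ j) \<longlongrightarrow> (0::real^'n) $ j) (at_right 0)"
    by simp
qed

lemma GDERIV_dilation:
  assumes "GDERIV f (dilation \<sigma> r x) :> g"
  shows "GDERIV (\<lambda>x. f (dilation \<sigma> r x)) x :> dilation \<sigma> r g"
  using has_derivative_compose[OF dilation_has_derivative assms[unfolded gderiv_def]]
  by (simp add: gderiv_def dilation_inner)

text \<open>The coefficient functions are recovered by applying the field to the coordinate functions.\<close>

lemma homogeneous_coefficient: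
  fixes Y :: "'n::finite vfield"
  assumes "homogeneous_deg1 \<sigma> Y" and "0 < r"
  shows "r ^ \<sigma> j * Y x $ j = r * Y (dilation \<sigma> r x) $ j"
proof -
  have "GDERIV (\<lambda>y::real^'n. (dilation \<sigma> r y) $ j) x :> dilation \<sigma> r (axis j 1)"
    by (rule GDERIV_dilation) (rule GDERIV_component)
  then have "vf_apply Y ((\<lambda>y. y $ j) \<circ> dilation \<sigma> r) x = r ^ \<sigma> j * Y x $ j"
    unfolding comp_def by (simp add: vf_apply_GDERIV dilation_axis inner_axis del: dilation_nth)
  moreover have "vf_apply Y (\<lambda>y. y $ j) (dilation \<sigma> r x) = Y (dilation \<sigma> r x) $ j"
    by (simp add: vf_apply_GDERIV[OF GDERIV_component] inner_axis)
  ultimately show ?thesis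
    using assms smooth_component[of j] unfolding homogeneous_deg1_def by metis
qed

text \<open>
  The \<open>j\<close>-th coefficient has weight \<open>\<sigma> j - 1\<close>, so it cannot depend on the \<open>j\<close>-th variable. In
  particular the field is divergence free, which makes \<open>- Y\<close> its formal adjoint.
\<close>

lemma homogeneous_diagonal_deriv:
  fixes Y :: "'n::finite vfield"
  assumes hom: "homogeneous_deg1 \<sigma> Y" and "smooth_vf Y" and "\<And>j. 1 \<le> \<sigma> j"
  shows "axis j 1 \<bullet> grad (\<lambda>y. Y y $ j) x = 0"
proof -
  let ?f = "\<lambda>y. Y y $ j"
  have f: "smooth ?f" using \<open>smooth_vf Y\<close> by (simp add: smooth_vf_def)
  have eq: "axis j 1 \<bullet> grad ?f x = r * (axis j 1 \<bullet> grad ?f (dilation \<sigma> r x))" if "0 < r" for r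
  proof -
    have "GDERIV (\<lambda>y. r * ?f (dilation \<sigma> r y)) x :> r *\<^sub>R dilation \<sigma> r (grad ?f (dilation \<sigma> r x)) + ?f (dilation \<sigma> r x) *\<^sub>R 0"
      by (intro GDERIV_mult GDERIV_const GDERIV_dilation smooth_GDERIV f)
    moreover have "GDERIV (\<lambda>y. r ^ \<sigma> j * ?f y) x :> r ^ \<sigma> j *\<^sub>R grad ?f x + ?f x *\<^sub>R 0"
      by (intro GDERIV_mult GDERIV_const smooth_GDERIV f)
    ultimately have "r *\<^sub>R dilation \<sigma> r (grad ?f (dilation \<sigma> r x)) = r ^ \<sigma> j *\<^sub>R grad ?f x"
      unfolding homogeneous_coefficient[OF hom that] by (simp add: GDERIV_unique)
    then have "r * (dilation \<sigma> r (axis j 1) \<bullet> grad ?f (dilation \<sigma> r x)) = r ^ \<sigma> j * (axis j 1 \<bullet> grad ?f x)"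
      unfolding dilation_inner by (simp only: flip: inner_scaleR_right)
    then have "r ^ \<sigma> j * (r * (axis j 1 \<bullet> grad ?f (dilation \<sigma> r x))) = r ^ \<sigma> j * (axis j 1 \<bullet> grad ?f x)"
      by (simp add: dilation_axis mult_ac)
    with that show ?thesis by simp
  qed
  have "isCont (grad ?f) 0"
    using smooth_continuous_grad[OF f] by (simp add: continuous_on_eq_continuous_at)
  then have "((\<lambda>r. grad ?f (dilation \<sigma> r x)) \<longlongrightarrow> grad ?f 0) (at_right 0)"
    using dilation_tendsto_0[OF assms(3)] by (rule isCont_tendsto_compose)
  then have "((\<lambda>r. r * (axis j 1 \<bullet> grad ?f (dilation \<sigma> r x))) \<longlongrightarrow> 0 * (axis j 1 \<bullet> grad ?f 0)) (at_right 0)"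
    by (intro tendsto_mult tendsto_inner tendsto_const tendsto_ident_at)
  moreover have "\<forall>\<^sub>F r in at_right 0. r * (axis j 1 \<bullet> grad ?f (dilation \<sigma> r x)) = axis j 1 \<bullet> grad ?f x"
    using eventually_at_right_less[of 0] by eventually_elim (simp only: eq)
  ultimately have "((\<lambda>r::real. axis j 1 \<bullet> grad ?f x) \<longlongrightarrow> 0 * (axis j 1 \<bullet> grad ?f 0)) (at_right 0)"
    by (rule Lim_transform_eventually)
  then show ?thesis
    by (simp add: tendsto_const_iff)
qed

text \<open>
  Euler's identity for the coefficients; in terms of operators it says \<open>[Y, T] = Y\<close>.
\<close>

lemma homogeneous_euler:
  fixes Y :: "'n::finite vfield"
  assumes hom: "homogeneous_deg1 \<sigma> Y" and "smooth_vf Y"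
  shows "T_field \<sigma> x \<bullet> grad (\<lambda>y. Y y $ j) x = (real (\<sigma> j) - 1) * Y x $ j"
proof -
  let ?f = "\<lambda>y. Y y $ j"
  have f: "smooth ?f" using \<open>smooth_vf Y\<close> by (simp add: smooth_vf_def)
  have one: "dilation \<sigma> 1 x = x" by (simp add: vec_eq_iff)
  have dil: "((\<lambda>r. dilation \<sigma> r x) has_derivative (\<lambda>s. s *\<^sub>R T_field \<sigma> x)) (at 1)"
  proof -
    have "((\<lambda>r. dilation \<sigma> r x) has_derivative (\<lambda>s. \<chi> k. s * (real (\<sigma> k) * x $ k))) (at 1)"
      by (rule has_derivative_vecI) (auto intro!: derivative_eq_intros)
    then show ?thesis
      by (simp add: T_field_def scaleR_vec_def)
  qed
  have "GDERIV ?f (dilation \<sigma> 1 x) :> grad ?f x"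
    unfolding one by (rule smooth_GDERIV[OF f])
  then have "((\<lambda>r. ?f (dilation \<sigma> r x)) has_derivative (\<lambda>s. (s *\<^sub>R T_field \<sigma> x) \<bullet> grad ?f x)) (at 1)"
    unfolding gderiv_def by (rule has_derivative_compose[OF dil])
  then have "((\<lambda>r. r * ?f (dilation \<sigma> r x)) has_derivative
      (\<lambda>s. s * (T_field \<sigma> x \<bullet> grad ?f x + ?f x))) (at 1)"
    by (auto intro!: derivative_eq_intros simp: one algebra_simps)
  then have "((\<lambda>r. r ^ \<sigma> j * ?f x) has_derivative (\<lambda>s. s * (T_field \<sigma> x \<bullet> grad ?f x + ?f x))) (at 1)"
    by (rule has_derivative_transform_within_open[of _ _ _ _ "{0<..}"])
       (auto simp: homogeneous_coefficient[OF hom])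
  moreover have "((\<lambda>r::real. r ^ \<sigma> j * ?f x) has_derivative (\<lambda>s. s * (real (\<sigma> j) * ?f x))) (at 1)"
    by (auto intro!: derivative_eq_intros)
  ultimately have "(\<lambda>s. s * (T_field \<sigma> x \<bullet> grad ?f x + ?f x)) = (\<lambda>s. s * (real (\<sigma> j) * ?f x))"
    by (rule has_derivative_unique)
  then have "1 * (T_field \<sigma> x \<bullet> grad ?f x + ?f x) = 1 * (real (\<sigma> j) * ?f x)"
    by (rule fun_cong)
  then show ?thesis by (simp add: algebra_simps)
qed

text \<open>
  The spanning condition is only available near the origin. Dilations carry an arbitrary point
  there: by homogeneity, the rescaled function is again annihilated by the fields.
\<close>

lemma homogeneous_family_annihilates_imp_grad_0:
  fixes X :: "'m \<Rightarrow> 'n::finite vfield" and w :: "real^'n \<Rightarrow> real"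
  assumes X: "\<forall>i. smooth_vf (X i)" and hom: "\<forall>i. homogeneous_deg1 \<sigma> (X i)"
    and \<sigma>: "\<And>j. 1 \<le> \<sigma> j" and H2: "dim {Y 0 | Y. Y \<in> Lie X} = CARD('n)"
    and "open S" and w: "\<forall>y\<in>S. GDERIV w y :> g y"
    and g: "\<And>y. y \<in> S \<Longrightarrow> (g has_derivative H y) (at y)"
    and ann: "\<And>i y. y \<in> S \<Longrightarrow> X i y \<bullet> g y = 0" and "x \<in> S"
  shows "g x = 0"
proof -
  have "\<forall>\<^sub>F r in at_right 0. \<forall>v. (\<forall>Y\<in>Lie X. Y (dilation \<sigma> r x) \<bullet> v = 0) \<longrightarrow> v = 0"
    using Lie_spans_near_0[OF X H2] dilation_tendsto_0[OF \<sigma>]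
    by (rule eventually_compose_filterlim)
  then have "\<forall>\<^sub>F r in at_right 0. 0 < r \<and> (\<forall>v. (\<forall>Y\<in>Lie X. Y (dilation \<sigma> r x) \<bullet> v = 0) \<longrightarrow> v = 0)"
    using eventually_at_right_less[of 0] by eventually_elim auto
  then obtain r where r: "0 < r"
    and span: "\<And>v. (\<And>Y. Y \<in> Lie X \<Longrightarrow> Y (dilation \<sigma> r x) \<bullet> v = 0) \<Longrightarrow> v = 0"
    using eventually_happens'[OF trivial_limit_at_right_real] by blast
  define \<delta> where "\<delta> = (dilation \<sigma> (1 / r) :: real^'n \<Rightarrow> real^'n)"
  have \<delta>x: "\<delta> (dilation \<sigma> r x) = x"
    using r by (simp add: \<delta>_def dilation_inverse)
  define S' where "S' = \<delta> -` S"
  have cont: "continuous_on UNIV \<delta>"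
    unfolding \<delta>_def by (intro linear_continuous_on linear_conv_bounded_linear[THEN iffD1] linear_dilation)
  have "open S'"
    unfolding S'_def using open_vimage[OF \<open>open S\<close> cont] .
  have w': "\<forall>y\<in>S'. GDERIV (\<lambda>y. w (\<delta> y)) y :> \<delta> (g (\<delta> y))"
    unfolding \<delta>_def using w by (auto simp: S'_def \<delta>_def intro!: GDERIV_dilation)
  have g': "((\<lambda>y. \<delta> (g (\<delta> y))) has_derivative (\<lambda>h. \<delta> (H (\<delta> y) (\<delta> h)))) (at y)" if "y \<in> S'" for y
  proof -
    have "(g has_derivative H (\<delta> y)) (at (\<delta> y))"
      using that by (intro g) (simp add: S'_def)
    then have "((\<lambda>y. g (\<delta> y)) has_derivative (\<lambda>h. H (\<delta> y) (\<delta> h))) (at y)"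
      using dilation_has_derivative unfolding \<delta>_def by (rule has_derivative_compose[rotated])
    then show ?thesis
      using dilation_has_derivative unfolding \<delta>_def by (rule has_derivative_compose)
  qed
  have ann': "X i y \<bullet> \<delta> (g (\<delta> y)) = 0" if "y \<in> S'" for i y
  proof -
    have "\<delta> (X i y) = (1 / r) *\<^sub>R X i (\<delta> y)"
      using homogeneous_coefficient[of \<sigma> "X i" "1 / r"] hom r by (simp add: vec_eq_iff \<delta>_def)
    moreover have "X i (\<delta> y) \<bullet> g (\<delta> y) = 0"
      using that by (intro ann) (simp add: S'_def)
    ultimately have "\<delta> (X i y) \<bullet> g (\<delta> y) = 0" by simp
    then show ?thesis by (simp add: \<delta>_def dilation_inner)
  qed
  have "dilation \<sigma> r x \<in> S'"
    using \<open>x \<in> S\<close> by (simp add: S'_def \<delta>x)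
  then have "\<delta> (g (\<delta> (dilation \<sigma> r x))) = 0"
    by (intro span Lie_annihilates[OF \<open>open S'\<close> w' g' X ann'])
  then have "\<delta> (g x) = 0" by (simp add: \<delta>x)
  then show ?thesis
    using r by (simp add: \<delta>_def vec_eq_iff)
qed

section \<open>The gradient at the boundary\<close>

text \<open>
  Near a boundary point with normal \<open>\<nu>\<close>, any cone narrower than a half space around \<open>- \<nu>\<close> lies inside
  \<open>\<Omega>\<close> and the opposite cone lies outside. Differentiability of the defining function at the single
  point \<open>x\<close> is enough.
\<close>

lemma boundary_cones:
  assumes \<nu>: "outward_unit_normal \<Omega> x \<nu>" and "0 < k"
  obtains d where "0 < d"
    and "\<And>w. \<lbrakk>w \<noteq> 0; norm w < d; w \<bullet> \<nu> \<le> - k * norm w\<rbrakk> \<Longrightarrow> x + w \<in> \<Omega>"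
    and "\<And>w. \<lbrakk>w \<noteq> 0; norm w < d; k * norm w \<le> w \<bullet> \<nu>\<rbrakk> \<Longrightarrow> x + w \<notin> \<Omega>"
proof -
  obtain U \<phi> where U: "open U" "x \<in> U" and \<phi>: "\<phi> x = 0" "\<phi> differentiable (at x)" "grad \<phi> x \<noteq> 0"
    and \<Omega>: "\<Omega> \<inter> U = {y\<in>U. \<phi> y < 0}" and n: "\<nu> = grad \<phi> x /\<^sub>R norm (grad \<phi> x)"
    using \<nu> unfolding outward_unit_normal_def by blast
  define c where "c = norm (grad \<phi> x)"
  have c: "0 < c" "grad \<phi> x = c *\<^sub>R \<nu>" using \<phi>(3) by (simp_all add: c_def n)
  obtain d1 where d1: "0 < d1" "\<And>y. norm (y - x) < d1 \<Longrightarrow> y \<in> U"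
    using U by (metis dist_norm open_dist)
  have "0 < c * k / 2" using c \<open>0 < k\<close> by simp
  then obtain d2 where d2: "0 < d2" "\<And>y. norm (y - x) < d2 \<Longrightarrow>
      norm (\<phi> y - \<phi> x - (y - x) \<bullet> grad \<phi> x) \<le> c * k / 2 * norm (y - x)"
    using GDERIV_grad[OF \<phi>(2)] unfolding gderiv_def has_derivative_at_alt by blast
  have est: "\<bar>\<phi> (x + w) - c * (w \<bullet> \<nu>)\<bar> \<le> c * (k * norm w / 2)" "x + w \<in> U"
    "x + w \<in> \<Omega> \<longleftrightarrow> \<phi> (x + w) < 0" if "norm w < min d1 d2" for w
    using d1(2)[of "x + w"] d2(2)[of "x + w"] that \<Omega> by (auto simp: \<phi>(1) c)
  have pos: "0 < c * (k * norm w / 2)" if "w \<noteq> 0" for w :: "real^'a"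
    using that c \<open>0 < k\<close> by simp
  show thesis
  proof (rule that[of "min d1 d2"])
    show "0 < min d1 d2" using d1 d2 by simp
    fix w :: "real^'a"
    assume w: "w \<noteq> 0" "norm w < min d1 d2"
    show "x + w \<in> \<Omega>" if "w \<bullet> \<nu> \<le> - k * norm w"
    proof -
      have "c * (w \<bullet> \<nu>) \<le> c * (- k * norm w)" using that c by (intro mult_left_mono) auto
      also have "\<dots> = - 2 * (c * (k * norm w / 2))" by simp
      finally have "\<phi> (x + w) < 0" using est(1)[OF w(2)] pos[OF w(1)] by linarith
      then show ?thesis using est(3)[OF w(2)] by simp
    qed
    show "x + w \<notin> \<Omega>" if "k * norm w \<le> w \<bullet> \<nu>"
    proof -
      have "2 * (c * (k * norm w / 2)) \<le> c * (w \<bullet> \<nu>)" using that c by simp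
      then have "0 < \<phi> (x + w)" using est(1)[OF w(2)] pos[OF w(1)] by linarith
      then show ?thesis using est(3)[OF w(2)] by simp
    qed
  qed
qed

lemma gradient_increment_segment:
  fixes u :: "'a::euclidean_space \<Rightarrow> real"
  assumes u: "continuous_on (closure \<Omega>) u" "\<And>y. y \<in> \<Omega> \<Longrightarrow> GDERIV u y :> G y"
    and seg: "open_segment a b \<subseteq> \<Omega>" "a \<in> closure \<Omega>" "b \<in> closure \<Omega>"
    and ball: "a \<in> ball x d" "b \<in> ball x d"
    and G: "\<And>y. y \<in> \<Omega> \<Longrightarrow> y \<in> ball x d \<Longrightarrow> norm (G y - g) \<le> e"
  shows "\<bar>u b - u a - (b - a) \<bullet> g\<bar> \<le> e * norm (b - a)"
proof (cases "a = b")
  case False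
  have "closed_segment a b \<subseteq> closure \<Omega>"
    using seg closure_subset[of \<Omega>] by (auto simp: closed_segment_eq_open)
  then have "continuous_on (closed_segment a b) u"
    using u(1) continuous_on_subset by blast
  then obtain y where y: "y \<in> open_segment a b" "u b - u a = (b - a) \<bullet> G y"
    using GDERIV_mvt_segment[of a b u G] u(2) seg(1) False by blast
  have "y \<in> ball x d"
    using y(1) closed_segment_subset[OF ball convex_ball] by (auto simp: open_segment_def)
  then have "norm (G y - g) \<le> e" using y(1) seg(1) G by blast
  have "u b - u a - (b - a) \<bullet> g = (b - a) \<bullet> (G y - g)"
    by (simp add: y(2) inner_diff_right)
  then have "\<bar>u b - u a - (b - a) \<bullet> g\<bar> \<le> norm (b - a) * norm (G y - g)"
    using Cauchy_Schwarz_ineq2[of "b - a" "G y - g"] by simp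
  also have "\<dots> \<le> norm (b - a) * e"
    using \<open>norm (G y - g) \<le> e\<close> by (intro mult_left_mono) auto
  finally show ?thesis by (simp add: mult.commute)
qed simp

text \<open>
  For a tangent vector \<open>v\<close> and small \<open>t\<close>, move inside \<open>\<Omega>\<close> from \<open>x\<close> to \<open>x - t \<nu>\<close>, then to
  \<open>x + t v - t \<nu>\<close>, and then in the direction \<open>\<nu>\<close> up to the first boundary point, which lies within
  \<open>e t\<close> of \<open>x + t v\<close>. Since \<open>u\<close> vanishes at both ends of this path, the mean value theorem on its
  three segments bounds the derivative along \<open>v\<close> of the extended gradient by a multiple of \<open>e\<close>.
\<close>

lemma tangential_gradient_small:
  fixes u :: "real^'n \<Rightarrow> real"
  assumes "open \<Omega>" and \<nu>: "outward_unit_normal \<Omega> x \<nu>"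
    and u: "continuous_on (closure \<Omega>) u" "\<And>y. y \<in> \<Omega> \<Longrightarrow> GDERIV u y :> G y"
    and G: "continuous_on (closure \<Omega>) G" and zero: "\<And>y. y \<in> frontier \<Omega> \<Longrightarrow> u y = 0"
    and v: "v \<bullet> \<nu> = 0" and e: "0 < e" "e < 1"
  shows "\<bar>v \<bullet> G x\<bar> \<le> e * (norm v + 3 + norm (G x))"
proof -
  have x: "x \<in> frontier \<Omega>" and n1: "norm \<nu> = 1"
    using \<nu> by (auto simp: outward_unit_normal_def)
  have nn: "\<nu> \<bullet> \<nu> = 1" using n1 by (simp add: norm_eq_1)
  have xc: "x \<in> closure \<Omega>" using x by (simp add: frontier_def)
  \<comment> \<open>\<open>R\<close> bounds the vectors \<open>a v + s \<nu>\<close> used below; \<open>k R = e\<close> then puts those with \<open>s \<le> - e\<close> in the inner cone\<close>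
  define R where "R = norm v + 2"
  have R: "2 \<le> R" by (simp add: R_def)
  define k where "k = e / R"
  have k: "0 < k" "k \<le> 1" "k * R = e" using e R by (auto simp: k_def field_simps)
  obtain d1 where d1: "0 < d1"
    and inner: "\<And>w. \<lbrakk>w \<noteq> 0; norm w < d1; w \<bullet> \<nu> \<le> - k * norm w\<rbrakk> \<Longrightarrow> x + w \<in> \<Omega>"
    and outer: "\<And>w. \<lbrakk>w \<noteq> 0; norm w < d1; k * norm w \<le> w \<bullet> \<nu>\<rbrakk> \<Longrightarrow> x + w \<notin> \<Omega>"
    using boundary_cones[OF \<nu> k(1)] by metis
  obtain d2 where d2: "0 < d2" "\<And>y. y \<in> closure \<Omega> \<Longrightarrow> dist y x < d2 \<Longrightarrow> dist (G y) (G x) < e"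
    using G xc e(1) unfolding continuous_on_iff by metis
  define t where "t = min d1 d2 / (2 * R)"
  have t: "0 < t" using d1 d2(1) R by (simp add: t_def)
  have tR: "t * R < d1" "t * R < d2" using d1 d2(1) R by (auto simp: t_def min_def)
  have norm_le: "norm (t *\<^sub>R (a *\<^sub>R v + s *\<^sub>R \<nu>)) \<le> t * R" if "0 \<le> a" "a \<le> 1" "\<bar>s\<bar> \<le> 1" for a s
  proof -
    have "norm (a *\<^sub>R v + s *\<^sub>R \<nu>) \<le> a * norm v + \<bar>s\<bar>"
      using norm_triangle_ineq[of "a *\<^sub>R v" "s *\<^sub>R \<nu>"] that n1 by simp
    also have "\<dots> \<le> R" using that mult_left_le_one_le[of "norm v" a] by (simp add: R_def)
    finally show ?thesis using t by simp
  qed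
  let ?p = "\<lambda>a s. x + t *\<^sub>R (a *\<^sub>R v + s *\<^sub>R \<nu>)"
  have in_ball: "?p a s \<in> ball x d2" if "0 \<le> a" "a \<le> 1" "\<bar>s\<bar> \<le> 1" for a s
    using norm_le[OF that] tR(2) by (simp add: dist_norm)
  have dot: "(t *\<^sub>R (a *\<^sub>R v + s *\<^sub>R \<nu>)) \<bullet> \<nu> = t * s" for a s
    by (simp add: inner_add_left v nn)
  have k_le: "k * norm (t *\<^sub>R (a *\<^sub>R v + s *\<^sub>R \<nu>)) \<le> t * e" if "0 \<le> a" "a \<le> 1" "\<bar>s\<bar> \<le> 1" for a s
  proof -
    have "k * norm (t *\<^sub>R (a *\<^sub>R v + s *\<^sub>R \<nu>)) \<le> k * (t * R)"
      using norm_le[OF that] k(1) by simp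
    also have "\<dots> = t * e" by (simp add: k(3)[symmetric])
    finally show ?thesis .
  qed
  have nz: "t *\<^sub>R (a *\<^sub>R v + s *\<^sub>R \<nu>) \<noteq> 0" if "s \<noteq> 0" for a s
    using dot[of a s] that t by auto
  have in_\<Omega>: "?p a s \<in> \<Omega>" if "0 \<le> a" "a \<le> 1" "- 1 \<le> s" "s \<le> - e" for a s
  proof (rule inner)
    have "t * s \<le> t * - e" using that(4) t by (intro mult_left_mono) auto
    then show "(t *\<^sub>R (a *\<^sub>R v + s *\<^sub>R \<nu>)) \<bullet> \<nu> \<le> - k * norm (t *\<^sub>R (a *\<^sub>R v + s *\<^sub>R \<nu>))"
      using k_le[of a s] that e unfolding dot by auto
    show "norm (t *\<^sub>R (a *\<^sub>R v + s *\<^sub>R \<nu>)) < d1"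
      using norm_le[of a s] tR(1) that e by auto
    show "t *\<^sub>R (a *\<^sub>R v + s *\<^sub>R \<nu>) \<noteq> 0"
      using that e by (intro nz) auto
  qed
  have in_\<Omega>0: "?p 0 s \<in> \<Omega>" if "- 1 \<le> s" "s < 0" for s
  proof (rule inner)
    have "norm (t *\<^sub>R (0 *\<^sub>R v + s *\<^sub>R \<nu>)) = t * - s"
      using that t n1 by (simp add: abs_mult)
    moreover have "k * (t * - s) \<le> t * - s"
      using that t k by (intro mult_left_le_one_le) (auto simp: mult_le_0_iff)
    ultimately show "(t *\<^sub>R (0 *\<^sub>R v + s *\<^sub>R \<nu>)) \<bullet> \<nu> \<le> - k * norm (t *\<^sub>R (0 *\<^sub>R v + s *\<^sub>R \<nu>))"
      unfolding dot by simp
    show "norm (t *\<^sub>R (0 *\<^sub>R v + s *\<^sub>R \<nu>)) < d1"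
      using norm_le[of 0 s] tR(1) that by auto
    show "t *\<^sub>R (0 *\<^sub>R v + s *\<^sub>R \<nu>) \<noteq> 0"
      using that by (intro nz) auto
  qed
  have out: "?p 1 e \<notin> \<Omega>"
  proof (rule outer)
    show "k * norm (t *\<^sub>R (1 *\<^sub>R v + e *\<^sub>R \<nu>)) \<le> (t *\<^sub>R (1 *\<^sub>R v + e *\<^sub>R \<nu>)) \<bullet> \<nu>"
      using k_le[of 1 e] e unfolding dot by auto
    show "norm (t *\<^sub>R (1 *\<^sub>R v + e *\<^sub>R \<nu>)) < d1"
      using norm_le[of 1 e] tR(1) e by auto
    show "t *\<^sub>R (1 *\<^sub>R v + e *\<^sub>R \<nu>) \<noteq> 0"
      using e by (intro nz) auto
  qed
  \<comment> \<open>the parameters outside \<open>\<Omega>\<close>; the least of them, \<open>s0\<close>, is where the ray along \<open>\<nu>\<close> first leaves \<open>\<Omega>\<close>\<close>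
  define K where "K = {-1..e} \<inter> ?p 1 -` (- \<Omega>)"
  have "compact K"
    unfolding K_def using \<open>open \<Omega>\<close>
    by (intro compact_Int_closed closed_vimage continuous_intros) auto
  moreover have "e \<in> K" using out e by (simp add: K_def)
  then have "K \<noteq> {}" by blast
  ultimately obtain s0 where s0: "s0 \<in> K" "\<And>s. s \<in> K \<Longrightarrow> s0 \<le> s"
    by (metis compact_attains_inf)
  have s0e: "\<bar>s0\<bar> \<le> e"
  proof -
    have s0K: "- 1 \<le> s0" "s0 \<le> e" "?p 1 s0 \<notin> \<Omega>" using s0(1) by (auto simp: K_def)
    then have "\<not> s0 \<le> - e" using in_\<Omega>[of 1 s0] by auto
    with s0K show ?thesis by arith
  qed
  have below: "?p 1 s \<in> \<Omega>" if "- 1 \<le> s" "s < s0" for s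
  proof (rule ccontr)
    assume "?p 1 s \<notin> \<Omega>"
    moreover have "s \<le> e" using that s0e by arith
    ultimately have "s \<in> K" using that by (simp add: K_def)
    then show False using s0(2) that by fastforce
  qed
  have segpar: "\<exists>r. 0 < r \<and> r < 1 \<and> y = ?p (a + r * (a' - a)) (s + r * (s' - s))"
    if "y \<in> open_segment (?p a s) (?p a' s')" for y a a' s s'
    using that unfolding in_segment by (auto simp: algebra_simps)
  have seg1: "open_segment x (?p 0 (-1)) \<subseteq> \<Omega>"
  proof
    fix y assume "y \<in> open_segment x (?p 0 (-1))"
    then obtain r where "0 < r" "r < 1" "y = ?p 0 (- r)" using segpar[of y 0 0 0 "-1"] by auto
    then show "y \<in> \<Omega>" using in_\<Omega>0[of "- r"] by auto
  qed
  have seg2: "open_segment (?p 0 (-1)) (?p 1 (-1)) \<subseteq> \<Omega>"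
  proof
    fix y assume "y \<in> open_segment (?p 0 (-1)) (?p 1 (-1))"
    then obtain r where "0 < r" "r < 1" "y = ?p r (-1)" using segpar[of y 0 "-1" 1 "-1"] by auto
    then show "y \<in> \<Omega>" using in_\<Omega>[of r "-1"] e by auto
  qed
  have seg3: "open_segment (?p 1 (-1)) (?p 1 s0) \<subseteq> \<Omega>"
  proof
    fix y assume "y \<in> open_segment (?p 1 (-1)) (?p 1 s0)"
    then obtain r where r: "0 < r" "r < 1" "y = ?p 1 (- 1 + r * (s0 + 1))"
      using segpar[of y 1 "-1" 1 s0] by auto
    have "0 < s0 + 1" using s0e e by linarith
    then have "0 < r * (s0 + 1)" "r * (s0 + 1) < s0 + 1" using r(1,2) by auto
    then show "y \<in> \<Omega>" unfolding r(3) by (intro below) auto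
  qed
  have z_out: "?p 1 s0 \<notin> \<Omega>" using s0(1) by (simp add: K_def)
  have p1: "?p 1 (-1) \<in> \<Omega>" using in_\<Omega>[of 1 "-1"] e by simp
  have "?p 1 s0 \<in> closure (open_segment (?p 1 (-1)) (?p 1 s0))"
  proof -
    have "?p 1 (-1) \<noteq> ?p 1 s0" using p1 z_out by metis
    then show ?thesis unfolding closure_open_segment by (simp only: if_False ends_in_segment)
  qed
  then have z_cl: "?p 1 s0 \<in> closure \<Omega>"
    using closure_mono[OF seg3] by blast
  then have z_fr: "?p 1 s0 \<in> frontier \<Omega>"
    using z_out \<open>open \<Omega>\<close> by (simp add: frontier_def interior_open)
  have cl: "?p 0 (-1) \<in> closure \<Omega>" "?p 1 (-1) \<in> closure \<Omega>"
    using p1 in_\<Omega>0[of "-1"] closure_subset[of \<Omega>] by auto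
  have Gle: "norm (G y - G x) \<le> e" if "y \<in> \<Omega>" "y \<in> ball x d2" for y
    using d2(2)[of y] that closure_subset[of \<Omega>] by (auto simp: dist_norm norm_minus_commute dist_commute)
  have steps: "?p 0 (-1) - x = t *\<^sub>R (- \<nu>)" "?p 1 (-1) - ?p 0 (-1) = t *\<^sub>R v"
    "?p 1 s0 - ?p 1 (-1) = t *\<^sub>R ((1 + s0) *\<^sub>R \<nu>)"
    by (simp_all add: algebra_simps)
  have norms: "norm (t *\<^sub>R (- \<nu>)) = t" "norm (t *\<^sub>R v) = t * norm v"
    "norm (t *\<^sub>R ((1 + s0) *\<^sub>R \<nu>)) \<le> t * 2"
    using t n1 s0e e by auto
  have I1: "\<bar>u (?p 0 (-1)) - u x - (t *\<^sub>R (- \<nu>)) \<bullet> G x\<bar> \<le> e * t"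
  proof -
    have "\<bar>u (?p 0 (-1)) - u x - (?p 0 (-1) - x) \<bullet> G x\<bar> \<le> e * norm (?p 0 (-1) - x)"
      using d2(1) in_ball[of 0 "-1"]
      by (intro gradient_increment_segment[OF u seg1 xc cl(1) _ _ Gle]) auto
    then show ?thesis unfolding steps norms .
  qed
  have I2: "\<bar>u (?p 1 (-1)) - u (?p 0 (-1)) - (t *\<^sub>R v) \<bullet> G x\<bar> \<le> e * (t * norm v)"
  proof -
    have "\<bar>u (?p 1 (-1)) - u (?p 0 (-1)) - (?p 1 (-1) - ?p 0 (-1)) \<bullet> G x\<bar>
        \<le> e * norm (?p 1 (-1) - ?p 0 (-1))"
      using in_ball[of 0 "-1"] in_ball[of 1 "-1"]
      by (intro gradient_increment_segment[OF u seg2 cl _ _ Gle]) auto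
    then show ?thesis unfolding steps norms .
  qed
  have I3: "\<bar>u (?p 1 s0) - u (?p 1 (-1)) - (t *\<^sub>R ((1 + s0) *\<^sub>R \<nu>)) \<bullet> G x\<bar> \<le> e * (t * 2)"
  proof -
    have "\<bar>u (?p 1 s0) - u (?p 1 (-1)) - (?p 1 s0 - ?p 1 (-1)) \<bullet> G x\<bar>
        \<le> e * norm (?p 1 s0 - ?p 1 (-1))"
      using in_ball[of 1 "-1"] in_ball[of 1 s0] s0e e
      by (intro gradient_increment_segment[OF u seg3 cl(2) z_cl _ _ Gle]) auto
    also have "\<dots> \<le> e * (t * 2)"
      unfolding steps using norms(3) e(1) by (intro mult_left_mono) auto
    finally show ?thesis unfolding steps .
  qed
  have zeros: "u x = 0" "u (?p 1 s0) = 0" using x z_fr zero by auto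
  define A where "A = (t *\<^sub>R (- \<nu>)) \<bullet> G x + (t *\<^sub>R v) \<bullet> G x + (t *\<^sub>R ((1 + s0) *\<^sub>R \<nu>)) \<bullet> G x"
  have "\<bar>A\<bar> \<le> e * t + e * (t * norm v) + e * (t * 2)"
    unfolding A_def using I1 I2 I3 unfolding zeros by linarith
  also have "\<dots> = t * (e * (norm v + 3))" by (simp add: algebra_simps)
  also have "A = t * (v \<bullet> G x + s0 * (\<nu> \<bullet> G x))"
    by (simp add: A_def algebra_simps)
  finally have "t * \<bar>v \<bullet> G x + s0 * (\<nu> \<bullet> G x)\<bar> \<le> t * (e * (norm v + 3))"
    using t by (simp add: abs_mult)
  then have "\<bar>v \<bullet> G x + s0 * (\<nu> \<bullet> G x)\<bar> \<le> e * (norm v + 3)" using t by simp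
  moreover have "\<bar>s0 * (\<nu> \<bullet> G x)\<bar> \<le> e * norm (G x)"
    unfolding abs_mult using s0e e Cauchy_Schwarz_ineq2[of \<nu> "G x"] n1 by (intro mult_mono) auto
  ultimately show ?thesis by (simp add: algebra_simps)
qed

text \<open>A function vanishing on the boundary has no tangential derivative there.\<close>

lemma boundary_gradient_normal:
  fixes u :: "real^'n \<Rightarrow> real"
  assumes "open \<Omega>" and \<nu>: "outward_unit_normal \<Omega> x \<nu>"
    and u: "continuous_on (closure \<Omega>) u" "\<And>y. y \<in> \<Omega> \<Longrightarrow> GDERIV u y :> G y"
    and G: "continuous_on (closure \<Omega>) G" and zero: "\<And>y. y \<in> frontier \<Omega> \<Longrightarrow> u y = 0"
  shows "G x = (\<nu> \<bullet> G x) *\<^sub>R \<nu>"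
proof -
  define v where "v = G x - (\<nu> \<bullet> G x) *\<^sub>R \<nu>"
  have "norm \<nu> = 1" using \<nu> by (auto simp: outward_unit_normal_def)
  then have v: "v \<bullet> \<nu> = 0"
    by (simp add: v_def inner_diff_left norm_eq_1 inner_commute[of "G x"])
  define C where "C = norm v + 3 + norm (G x)"
  have "0 < C" using norm_ge_zero[of v] norm_ge_zero[of "G x"] unfolding C_def by linarith
  have "\<bar>v \<bullet> G x\<bar> \<le> 0"
  proof (rule field_le_epsilon)
    fix e :: real assume "0 < e"
    define a where "a = min (e / C) (1 / 2)"
    have "0 < a" "a < 1" using \<open>0 < e\<close> \<open>0 < C\<close> by (auto simp: a_def)
    from tangential_gradient_small[OF assms(1) \<nu> u G zero v this]
    have "\<bar>v \<bullet> G x\<bar> \<le> a * C" by (simp add: C_def)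
    also have "\<dots> \<le> e" using \<open>0 < C\<close> by (simp add: a_def min_def field_simps)
    finally show "\<bar>v \<bullet> G x\<bar> \<le> 0 + e" by simp
  qed
  moreover have "v \<bullet> G x = v \<bullet> v"
    using v by (simp add: v_def inner_diff_right[of _ "G x"])
  ultimately have "v \<bullet> v = 0" using inner_ge_zero[of v] by linarith
  then have "v = 0" by simp
  then show ?thesis by (simp add: v_def)
qed

section \<open>Calculus of functions continuously differentiable up to the boundary\<close>

text \<open>
  \<open>G\<close> is the gradient of \<open>f\<close> in \<open>S\<close>, extended continuously to the closure. Carrying the extended
  gradient explicitly makes its boundary values available, which the partial derivatives of \<open>f\<close>
  themselves do not provide.
\<close>

definition C1_gradient :: "'a::euclidean_space set \<Rightarrow> ('a \<Rightarrow> real) \<Rightarrow> ('a \<Rightarrow> 'a) \<Rightarrow> bool" where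
  "C1_gradient S f G \<longleftrightarrow>
     continuous_on (closure S) f \<and> continuous_on (closure S) G \<and> (\<forall>x\<in>S. GDERIV f x :> G x)"

lemma C1_gradient_GDERIV: "C1_gradient S f G \<Longrightarrow> x \<in> S \<Longrightarrow> GDERIV f x :> G x"
  by (simp add: C1_gradient_def)

lemma C1_gradient_continuous: "C1_gradient S f G \<Longrightarrow> continuous_on (closure S) f"
  by (simp add: C1_gradient_def)

lemma C1_gradient_imp_Ck_closure:
  assumes "C1_gradient S f G"
  shows "Ck_closure 1 f S"
proof -
  have "f differentiable_on S"
    unfolding differentiable_on_def
    using assms by (auto simp: C1_gradient_def gderiv_def differentiable_def intro: has_derivative_at_withinI)
  moreover have "\<exists>g. (\<forall>x\<in>S. g x = partial_deriv b f x) \<and> continuous_on (closure S) g" for b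
    using assms
    by (intro exI[of _ "\<lambda>x. b \<bullet> G x"])
       (auto simp: C1_gradient_def partial_deriv_GDERIV intro!: continuous_intros)
  ultimately show ?thesis
    using assms by (simp add: C1_gradient_def)
qed

text \<open>
  The extended gradient is assembled from the extensions of the partial derivatives; it is one
  degree less differentiable than \<open>f\<close>.
\<close>

lemma Ck_closure_Suc_gradient:
  assumes "open S" "Ck_closure (Suc k) f S"
  obtains G where "continuous_on (closure S) f" "\<And>x. x \<in> S \<Longrightarrow> GDERIV f x :> G x"
    "\<And>b. b \<in> Basis \<Longrightarrow> Ck_closure k (\<lambda>x. b \<bullet> G x) S"
proof -
  have "\<forall>b\<in>Basis. \<exists>g. (\<forall>x\<in>S. g x = partial_deriv b f x) \<and> Ck_closure k g S"
    using assms(2) by simp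
  then obtain g where g: "\<And>b x. b \<in> Basis \<Longrightarrow> x \<in> S \<Longrightarrow> g b x = partial_deriv b f x"
    "\<And>b. b \<in> Basis \<Longrightarrow> Ck_closure k (g b) S"
    by metis
  define G where "G = (\<lambda>x. \<Sum>b\<in>Basis. g b x *\<^sub>R b)"
  have "(\<lambda>x. b \<bullet> G x) = g b" if "b \<in> Basis" for b
    using that by (simp add: G_def inner_sum_right inner_Basis if_distrib cong: if_cong)
  with g(2) have 1: "Ck_closure k (\<lambda>x. b \<bullet> G x) S" if "b \<in> Basis" for b
    using that by simp
  have 2: "GDERIV f x :> G x" if "x \<in> S" for x
  proof -
    have "f differentiable (at x)"
      using assms that by (auto simp: differentiable_on_eq_differentiable_at)
    then have "GDERIV f x :> grad f x" by (rule GDERIV_grad)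
    moreover have "grad f x = G x" using that by (simp add: grad_def G_def g(1))
    ultimately show ?thesis by simp
  qed
  have "continuous_on (closure S) f" using assms(2) by simp
  from that[OF this 2 1] show thesis .
qed

lemma Ck_closure_1_gradient:
  assumes "open S" "Ck_closure 1 f S"
  obtains G where "C1_gradient S f G"
proof -
  obtain G where G: "continuous_on (closure S) f" "\<And>x. x \<in> S \<Longrightarrow> GDERIV f x :> G x"
    "\<And>b. b \<in> Basis \<Longrightarrow> Ck_closure 0 (\<lambda>x. b \<bullet> G x) S"
    using Ck_closure_Suc_gradient[of S 0 f] assms by auto
  have "continuous_on (closure S) G"
    using G(3) continuous_on_componentwise[of "closure S" G] by (auto simp: inner_commute)
  with G that show thesis by (auto simp: C1_gradient_def)
qed

lemma C1_gradient_Ck_on: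
  assumes "Ck_on 1 f W" "open W" "closure S \<subseteq> W"
  shows "C1_gradient S f (grad f)"
  unfolding C1_gradient_def
proof (intro conjI ballI)
  have "continuous_on W f"
    using Ck_on_Suc_imp[of 0 f W] assms(1) by simp
  then show "continuous_on (closure S) f"
    using assms(3) continuous_on_subset by blast
  show "continuous_on (closure S) (grad f)"
    using continuous_on_grad[OF assms(1)] assms(3) continuous_on_subset by blast
  fix x assume "x \<in> S"
  then have "x \<in> W" using assms(3) closure_subset by blast
  then show "GDERIV f x :> grad f x"
    using assms(1,2) by (intro GDERIV_grad) (auto simp: differentiable_on_eq_differentiable_at)
qed

lemma C1_gradient_smooth: "smooth f \<Longrightarrow> C1_gradient S f (grad f)"
  by (rule C1_gradient_Ck_on[of _ UNIV]) (auto simp: smooth_def simp del: Ck_on.simps)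

lemma C1_gradient_const: "C1_gradient S (\<lambda>x. c) (\<lambda>x. 0)"
  by (simp add: C1_gradient_def GDERIV_const)

lemma C1_gradient_component: "C1_gradient S (\<lambda>x::real^'n. x $ j) (\<lambda>x. axis j 1)"
  by (auto simp: C1_gradient_def GDERIV_component intro!: continuous_intros)

lemma C1_gradient_add:
  "C1_gradient S f F \<Longrightarrow> C1_gradient S g G \<Longrightarrow> C1_gradient S (\<lambda>x. f x + g x) (\<lambda>x. F x + G x)"
  by (auto simp: C1_gradient_def intro!: continuous_intros GDERIV_add)

lemma C1_gradient_diff:
  "C1_gradient S f F \<Longrightarrow> C1_gradient S g G \<Longrightarrow> C1_gradient S (\<lambda>x. f x - g x) (\<lambda>x. F x - G x)"
  by (auto simp: C1_gradient_def intro!: continuous_intros GDERIV_diff)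

lemma C1_gradient_mult:
  "C1_gradient S f F \<Longrightarrow> C1_gradient S g G \<Longrightarrow>
    C1_gradient S (\<lambda>x. f x * g x) (\<lambda>x. f x *\<^sub>R G x + g x *\<^sub>R F x)"
  by (auto simp: C1_gradient_def intro!: continuous_intros GDERIV_mult)

lemma C1_gradient_cmult:
  "C1_gradient S f F \<Longrightarrow> C1_gradient S (\<lambda>x. c * f x) (\<lambda>x. c *\<^sub>R F x)"
  using C1_gradient_mult[OF C1_gradient_const] by force

lemma C1_gradient_sum:
  "(\<And>i. i \<in> I \<Longrightarrow> C1_gradient S (f i) (F i)) \<Longrightarrow>
    C1_gradient S (\<lambda>x. \<Sum>i\<in>I. f i x) (\<lambda>x. \<Sum>i\<in>I. F i x)"
  by (auto simp: C1_gradient_def intro!: continuous_intros GDERIV_sum)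

lemma C1_gradient_inner:
  fixes A B :: "'a::euclidean_space \<Rightarrow> real^'n"
  assumes "\<And>j. C1_gradient S (\<lambda>x. A x $ j) (DA j)" "\<And>j. C1_gradient S (\<lambda>x. B x $ j) (DB j)"
  shows "C1_gradient S (\<lambda>x. A x \<bullet> B x) (\<lambda>x. \<Sum>j\<in>UNIV. A x $ j *\<^sub>R DB j x + B x $ j *\<^sub>R DA j x)"
  unfolding inner_vec_def inner_real_def by (intro C1_gradient_sum C1_gradient_mult assms)

lemma continuous_on_graph:
  assumes "C1_gradient \<Omega> u G" and "\<And>i. C1_gradient \<Omega> (\<lambda>x. P x $ i) (PG i)"
  shows "continuous_on (closure \<Omega>) (\<lambda>x. (x, u x, P x :: real^'m))"
proof -
  have "continuous_on (closure \<Omega>) (\<lambda>x. \<chi> i. P x $ i)"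
    using assms(2) by (intro continuous_on_vec_lambda) (simp add: C1_gradient_def)
  then have "continuous_on (closure \<Omega>) P" by simp
  with assms(1) show ?thesis
    unfolding C1_gradient_def by (intro continuous_on_Pair continuous_on_id) auto
qed

text \<open>The chain rule along the graph \<open>x \<mapsto> (x, u x, P x)\<close>, up to the boundary.\<close>

lemma C1_gradient_compose_graph:
  fixes \<Phi> :: "(real^'n) \<times> real \<times> (real^'m) \<Rightarrow> real"
  assumes \<Phi>: "C1_gradient (\<Omega> \<times> UNIV) \<Phi> \<Gamma>" and u: "C1_gradient \<Omega> u G"
    and P: "\<And>i. C1_gradient \<Omega> (\<lambda>x. P x $ i) (PG i)"
  shows "C1_gradient \<Omega> (\<lambda>x. \<Phi> (x, u x, P x))
    (\<lambda>x. fst (\<Gamma> (x, u x, P x)) + fst (snd (\<Gamma> (x, u x, P x))) *\<^sub>R G x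
       + (\<Sum>i\<in>UNIV. snd (snd (\<Gamma> (x, u x, P x))) $ i *\<^sub>R PG i x))"
proof -
  have graph: "continuous_on (closure \<Omega>) (\<lambda>x. (x, u x, P x))"
    using u P by (rule continuous_on_graph)
  have comp: "continuous_on (closure \<Omega>) (\<lambda>x. \<Psi> (x, u x, P x))"
    if "continuous_on (closure (\<Omega> \<times> UNIV)) \<Psi>" for \<Psi> :: "(real^'n) \<times> real \<times> (real^'m) \<Rightarrow> 'c::topological_space"
    using that graph by (rule continuous_on_compose2) (auto simp: closure_Times)
  show ?thesis
    unfolding C1_gradient_def
  proof (intro conjI ballI)
    show "continuous_on (closure \<Omega>) (\<lambda>x. \<Phi> (x, u x, P x))"
      using \<Phi> by (intro comp) (simp add: C1_gradient_def)
    have "continuous_on (closure \<Omega>) (\<lambda>x. \<Gamma> (x, u x, P x))"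
      using \<Phi> by (intro comp) (simp add: C1_gradient_def)
    then show "continuous_on (closure \<Omega>) (\<lambda>x. fst (\<Gamma> (x, u x, P x)) + fst (snd (\<Gamma> (x, u x, P x))) *\<^sub>R G x
       + (\<Sum>i\<in>UNIV. snd (snd (\<Gamma> (x, u x, P x))) $ i *\<^sub>R PG i x))"
      using u P unfolding C1_gradient_def by (intro continuous_intros) auto
    fix x assume x: "x \<in> \<Omega>"
    have "(P has_derivative (\<lambda>h. \<chi> i. h \<bullet> PG i x)) (at x)"
      using P x unfolding C1_gradient_def gderiv_def by (intro has_derivative_vecI) auto
    moreover have "(u has_derivative (\<lambda>h. h \<bullet> G x)) (at x)"
      using u x unfolding C1_gradient_def gderiv_def by auto
    ultimately have "((\<lambda>x. (x, u x, P x)) has_derivative (\<lambda>h. (h, h \<bullet> G x, \<chi> i. h \<bullet> PG i x))) (at x)"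
      by (intro has_derivative_Pair has_derivative_ident)
    moreover have "(\<Phi> has_derivative (\<lambda>k. k \<bullet> \<Gamma> (x, u x, P x))) (at (x, u x, P x))"
      using \<Phi> x unfolding C1_gradient_def gderiv_def by auto
    ultimately have "((\<lambda>x. \<Phi> (x, u x, P x)) has_derivative
        (\<lambda>h. (h, h \<bullet> G x, \<chi> i. h \<bullet> PG i x) \<bullet> \<Gamma> (x, u x, P x))) (at x)"
      by (rule has_derivative_compose)
    moreover have "(h, h \<bullet> G x, \<chi> i. h \<bullet> PG i x) \<bullet> g =
        h \<bullet> (fst g + fst (snd g) *\<^sub>R G x + (\<Sum>i\<in>UNIV. snd (snd g) $ i *\<^sub>R PG i x))" for h g
      by (simp add: inner_prod_def inner_add_right inner_sum_right inner_vec_def[of "\<chi> i. _ i"] mult.commute)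
    ultimately show "GDERIV (\<lambda>x. \<Phi> (x, u x, P x)) x :> fst (\<Gamma> (x, u x, P x)) + fst (snd (\<Gamma> (x, u x, P x))) *\<^sub>R G x
       + (\<Sum>i\<in>UNIV. snd (snd (\<Gamma> (x, u x, P x))) $ i *\<^sub>R PG i x)"
      unfolding gderiv_def by simp
  qed
qed

lemma D_x_grad: "GDERIV F w :> \<Gamma> \<Longrightarrow> D_x i F w = fst \<Gamma> $ i"
  by (simp add: D_x_def partial_deriv_GDERIV inner_prod_def inner_axis')

lemma D_z_grad: "GDERIV F w :> \<Gamma> \<Longrightarrow> D_z F w = fst (snd \<Gamma>)"
  by (simp add: D_z_def partial_deriv_GDERIV inner_prod_def)

lemma D_p_grad: "GDERIV F w :> \<Gamma> \<Longrightarrow> D_p F w = snd (snd \<Gamma>)"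
  by (simp add: D_p_def partial_deriv_GDERIV inner_prod_def inner_axis' vec_eq_iff)

section \<open>The Pohozaev vector field\<close>

text \<open>The commutator relation \<open>[Y, T] = Y\<close>, applied to a twice differentiable function.\<close>

lemma homogeneous_commutator:
  fixes Y :: "'n::finite vfield" and G :: "real^'n \<Rightarrow> real^'n"
  assumes hom: "homogeneous_deg1 \<sigma> Y" and Y: "smooth_vf Y"
    and G: "(G has_derivative H) (at x)" and sym: "\<And>h k. h \<bullet> H k = k \<bullet> H h"
    and YG: "GDERIV (\<lambda>y. Y y \<bullet> G y) x :> a" and TG: "GDERIV (\<lambda>y. T_field \<sigma> y \<bullet> G y) x :> b"
  shows "Y x \<bullet> b = T_field \<sigma> x \<bullet> a + Y x \<bullet> G x"
proof -
  have T: "(T_field \<sigma> has_derivative T_field \<sigma>) (at x)"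
  proof -
    have "linear (T_field \<sigma> :: real^'n \<Rightarrow> real^'n)"
      by (rule linearI) (simp_all add: T_field_def vec_eq_iff algebra_simps)
    then show ?thesis
      by (intro bounded_linear_imp_has_derivative linear_conv_bounded_linear[THEN iffD1])
  qed
  have "((\<lambda>y. Y y \<bullet> G y) has_derivative (\<lambda>h. Y x \<bullet> H h + vf_deriv Y x h \<bullet> G x)) (at x)"
    by (intro has_derivative_inner G smooth_vf_has_derivative[OF Y])
  from has_derivative_unique[OF YG[unfolded gderiv_def] this]
  have a: "h \<bullet> a = Y x \<bullet> H h + vf_deriv Y x h \<bullet> G x" for h by (rule fun_cong)
  have "((\<lambda>y. T_field \<sigma> y \<bullet> G y) has_derivative (\<lambda>h. T_field \<sigma> x \<bullet> H h + T_field \<sigma> h \<bullet> G x)) (at x)"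
    by (intro has_derivative_inner G T)
  from has_derivative_unique[OF TG[unfolded gderiv_def] this]
  have b: "h \<bullet> b = T_field \<sigma> x \<bullet> H h + T_field \<sigma> h \<bullet> G x" for h by (rule fun_cong)
  have "vf_deriv Y x (T_field \<sigma> x) = T_field \<sigma> (Y x) - Y x"
    using homogeneous_euler[OF hom Y]
    by (simp add: vec_eq_iff vf_deriv_def T_field_def[of _ "Y x"] algebra_simps)
  then show ?thesis
    unfolding a[of "T_field \<sigma> x"] b[of "Y x"]
    using sym[of "T_field \<sigma> x" "Y x"] by (simp add: inner_diff_left)
qed

lemma pohozaev_field_C1:
  fixes X :: "'m::finite \<Rightarrow> 'n::finite vfield" and Q :: "'m \<Rightarrow> real^'n \<Rightarrow> real"
  assumes X: "\<forall>i. smooth_vf (X i)" and f: "C1_gradient \<Omega> f Gf" and s: "C1_gradient \<Omega> s Gs"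
    and Q: "\<And>i. C1_gradient \<Omega> (Q i) (GQ i)"
  shows "C1_gradient \<Omega> (\<lambda>x. (f x *\<^sub>R T_field \<sigma> x - s x *\<^sub>R (\<Sum>i\<in>UNIV. Q i x *\<^sub>R X i x)) $ j)
    (\<lambda>x. (f x *\<^sub>R (real (\<sigma> j) *\<^sub>R axis j 1) + (real (\<sigma> j) * x $ j) *\<^sub>R Gf x)
      - (s x *\<^sub>R (\<Sum>i\<in>UNIV. Q i x *\<^sub>R grad (\<lambda>y. X i y $ j) x + X i x $ j *\<^sub>R GQ i x)
         + (\<Sum>i\<in>UNIV. Q i x * X i x $ j) *\<^sub>R Gs x))"
proof -
  have eq: "(f x *\<^sub>R T_field \<sigma> x - s x *\<^sub>R (\<Sum>i\<in>UNIV. Q i x *\<^sub>R X i x)) $ j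
      = f x * (real (\<sigma> j) * x $ j) - s x * (\<Sum>i\<in>UNIV. Q i x * X i x $ j)" for x
    by (simp add: T_field_def)
  show ?thesis
    unfolding eq using X unfolding smooth_vf_def
    by (intro C1_gradient_diff C1_gradient_mult C1_gradient_sum C1_gradient_cmult
        C1_gradient_component C1_gradient_smooth f s Q) auto
qed

text \<open>
  The divergence for arbitrary scalar coefficients. The terms with derivatives of the coefficients
  of \<open>X\<^sub>i\<close> disappear because \<open>X\<^sub>i\<close> is divergence free.
\<close>

lemma pohozaev_field_divergence:
  fixes X :: "'m::finite \<Rightarrow> 'n::finite vfield" and Q :: "'m \<Rightarrow> real^'n \<Rightarrow> real"
  assumes X: "\<forall>i. smooth_vf (X i)" and hom: "\<forall>i. homogeneous_deg1 \<sigma> (X i)" and \<sigma>: "\<And>j. 1 \<le> \<sigma> j"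
    and f: "C1_gradient \<Omega> f Gf" and s: "C1_gradient \<Omega> s Gs"
    and Q: "\<And>i. C1_gradient \<Omega> (Q i) (GQ i)" and x: "x \<in> \<Omega>"
  shows "divergence (\<lambda>x. f x *\<^sub>R T_field \<sigma> x - s x *\<^sub>R (\<Sum>i\<in>UNIV. Q i x *\<^sub>R X i x)) x =
    real (\<Sum>k\<in>UNIV. \<sigma> k) * f x + T_field \<sigma> x \<bullet> Gf x
    - s x * (\<Sum>i\<in>UNIV. X i x \<bullet> GQ i x) - (\<Sum>i\<in>UNIV. Q i x * (X i x \<bullet> Gs x))"
proof -
  have diag: "grad (\<lambda>y. X i y $ j) x $ j = 0" for i j
    using homogeneous_diagonal_deriv[of \<sigma> "X i" j x] X hom \<sigma> by (simp add: inner_axis')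
  have "partial_deriv (axis j 1) (\<lambda>x. (f x *\<^sub>R T_field \<sigma> x - s x *\<^sub>R (\<Sum>i\<in>UNIV. Q i x *\<^sub>R X i x)) $ j) x
    = real (\<sigma> j) * f x + T_field \<sigma> x $ j * Gf x $ j - s x * (\<Sum>i\<in>UNIV. X i x $ j * GQ i x $ j)
      - (\<Sum>i\<in>UNIV. Q i x * (X i x $ j * Gs x $ j))" for j
    using partial_deriv_GDERIV[OF C1_gradient_GDERIV[OF pohozaev_field_C1[where j = j and \<sigma> = \<sigma>, OF X f s Q] x], where b = "axis j 1"]
    by (simp add: inner_axis' diag T_field_def sum_distrib_left mult_ac)
  then have "divergence (\<lambda>x. f x *\<^sub>R T_field \<sigma> x - s x *\<^sub>R (\<Sum>i\<in>UNIV. Q i x *\<^sub>R X i x)) x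
    = (\<Sum>j\<in>UNIV. real (\<sigma> j) * f x + T_field \<sigma> x $ j * Gf x $ j - s x * (\<Sum>i\<in>UNIV. X i x $ j * GQ i x $ j)
      - (\<Sum>i\<in>UNIV. Q i x * (X i x $ j * Gs x $ j)))"
    by (simp only: divergence_def)
  also have "\<dots> = real (\<Sum>k\<in>UNIV. \<sigma> k) * f x + (\<Sum>j\<in>UNIV. T_field \<sigma> x $ j * Gf x $ j)
    - s x * (\<Sum>j\<in>UNIV. \<Sum>i\<in>UNIV. X i x $ j * GQ i x $ j) - (\<Sum>j\<in>UNIV. \<Sum>i\<in>UNIV. Q i x * (X i x $ j * Gs x $ j))"
    by (simp add: sum.distrib sum_subtractf sum_distrib_right sum_distrib_left)
  also have "(\<Sum>j\<in>UNIV. \<Sum>i\<in>UNIV. X i x $ j * GQ i x $ j) = (\<Sum>i\<in>UNIV. X i x \<bullet> GQ i x)"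
    by (subst sum.swap) (simp add: inner_vec_def)
  also have "(\<Sum>j\<in>UNIV. \<Sum>i\<in>UNIV. Q i x * (X i x $ j * Gs x $ j)) = (\<Sum>i\<in>UNIV. Q i x * (X i x \<bullet> Gs x))"
    by (subst sum.swap) (simp add: inner_vec_def sum_distrib_left)
  finally show ?thesis by (simp add: inner_vec_def[of "T_field \<sigma> x"])
qed

text \<open>
  The components \<open>\<langle>X\<^sub>i, G\<rangle>\<close>. For \<open>G\<close> the continuous extension of the gradient of \<open>u\<close>, this is
  \<open>\<nabla>\<^sub>X u\<close>, extended to the boundary.
\<close>

definition horizontal :: "('m::finite \<Rightarrow> 'n::finite vfield) \<Rightarrow> (real^'n \<Rightarrow> real^'n) \<Rightarrow> real^'n \<Rightarrow> real^'m" where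
  "horizontal X G x = (\<chi> i. X i x \<bullet> G x)"

text \<open>
  \<open>F T - (T u + a\<^sub>0 u) \<Sum>\<^sub>i F\<^bsub>p\<^sub>i\<^esub> X\<^sub>i\<close> along the graph of \<open>(u, \<nabla>\<^sub>X u)\<close>, with \<open>T u\<close> and \<open>\<nabla>\<^sub>X u\<close> expressed
  through the extended gradient \<open>G\<close>.
\<close>

definition pohozaev_field ::
  "('m::finite \<Rightarrow> 'n::finite vfield) \<Rightarrow> ('n \<Rightarrow> nat) \<Rightarrow> real \<Rightarrow> ((real^'n) \<times> real \<times> (real^'m) \<Rightarrow> real) \<Rightarrow>
    (real^'n \<Rightarrow> real) \<Rightarrow> (real^'n \<Rightarrow> real^'n) \<Rightarrow> 'n vfield" where
  "pohozaev_field X \<sigma> a\<^sub>0 F u G x =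
     F (x, u x, horizontal X G x) *\<^sub>R T_field \<sigma> x
     - (T_field \<sigma> x \<bullet> G x + a\<^sub>0 * u x)
         *\<^sub>R (\<Sum>i\<in>UNIV. (D_p F (x, u x, horizontal X G x) $ i) *\<^sub>R X i x)"

lemma grad_X_eq_horizontal: "GDERIV u x :> G x \<Longrightarrow> grad_X X u x = horizontal X G x"
  by (simp add: grad_X_def horizontal_def vf_apply_GDERIV)

text \<open>
  The Pohozaev identity in differential form. The second derivatives of \<open>u\<close> cancel by the
  commutator relation \<open>[X\<^sub>i, T] = X\<^sub>i\<close>, and the derivatives of \<open>F\<^sub>p\<close> are removed by the equation.
\<close>

lemma pohozaev_identity:
  fixes X :: "'m::finite \<Rightarrow> 'n::finite vfield" and F :: "(real^'n) \<times> real \<times> (real^'m) \<Rightarrow> real"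
  assumes X: "\<forall>i. smooth_vf (X i)" and hom: "\<forall>i. homogeneous_deg1 \<sigma> (X i)" and \<sigma>: "\<And>j. 1 \<le> \<sigma> j"
    and "open \<Omega>" and u: "C1_gradient \<Omega> u G" and G: "\<And>j. C1_gradient \<Omega> (\<lambda>x. G x $ j) (GG j)"
    and F: "C1_gradient (\<Omega> \<times> UNIV) F \<Gamma>"
    and F\<^sub>p: "\<And>i. C1_gradient (\<Omega> \<times> UNIV) (\<lambda>w. D_p F w $ i) (\<Gamma>\<^sub>p i)"
    and equation: "\<And>x. x \<in> \<Omega> \<Longrightarrow> div_X X (\<lambda>y. D_p F (y, u y, grad_X X u y)) x
                          + D_z F (x, u x, grad_X X u x) = 0"
  shows "Ck_closure 1 (\<lambda>x. pohozaev_field X \<sigma> a\<^sub>0 F u G x $ j) \<Omega>" (is ?C1)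
    and "x \<in> \<Omega> \<Longrightarrow> divergence (pohozaev_field X \<sigma> a\<^sub>0 F u G) x
      = structure_expr \<sigma> a\<^sub>0 F x (u x) (horizontal X G x)" (is "_ \<Longrightarrow> ?div")
proof -
  let ?P = "horizontal X G"
  define PG where "PG = (\<lambda>i x. \<Sum>j\<in>UNIV. X i x $ j *\<^sub>R GG j x + G x $ j *\<^sub>R grad (\<lambda>y. X i y $ j) x)"
  have P: "C1_gradient \<Omega> (\<lambda>x. X i x \<bullet> G x) (PG i)" for i
    unfolding PG_def using X
    by (intro C1_gradient_inner G C1_gradient_smooth) (simp add: smooth_vf_def)
  have P': "C1_gradient \<Omega> (\<lambda>x. ?P x $ i) (PG i)" for i
    using P by (simp add: horizontal_def)
  define TG where "TG = (\<lambda>x. \<Sum>j\<in>UNIV. T_field \<sigma> x $ j *\<^sub>R GG j x + G x $ j *\<^sub>R (real (\<sigma> j) *\<^sub>R axis j 1))"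
  have T: "C1_gradient \<Omega> (\<lambda>x. T_field \<sigma> x \<bullet> G x) TG"
    unfolding TG_def
  proof (intro C1_gradient_inner G)
    show "C1_gradient \<Omega> (\<lambda>x. T_field \<sigma> x $ j) (\<lambda>x. real (\<sigma> j) *\<^sub>R axis j 1)" for j
      unfolding T_field_def vec_lambda_beta by (intro C1_gradient_cmult C1_gradient_component)
  qed
  have s: "C1_gradient \<Omega> (\<lambda>x. T_field \<sigma> x \<bullet> G x + a\<^sub>0 * u x) (\<lambda>x. TG x + a\<^sub>0 *\<^sub>R G x)"
    by (intro C1_gradient_add C1_gradient_cmult T u)
  note f = C1_gradient_compose_graph[OF F u P']
  define GQ where "GQ = (\<lambda>i x. fst (\<Gamma>\<^sub>p i (x, u x, ?P x)) + fst (snd (\<Gamma>\<^sub>p i (x, u x, ?P x))) *\<^sub>R G x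
       + (\<Sum>k\<in>UNIV. snd (snd (\<Gamma>\<^sub>p i (x, u x, ?P x))) $ k *\<^sub>R PG k x))"
  have Q: "C1_gradient \<Omega> (\<lambda>x. D_p F (x, u x, ?P x) $ i) (GQ i)" for i
    unfolding GQ_def by (rule C1_gradient_compose_graph[OF F\<^sub>p u P'])
  show ?C1
    unfolding pohozaev_field_def[abs_def]
    by (rule C1_gradient_imp_Ck_closure[OF pohozaev_field_C1[OF X f s Q]])
  show ?div if x: "x \<in> \<Omega>"
  proof -
    let ?w = "(x, u x, ?P x)"
    have "GDERIV F ?w :> \<Gamma> ?w"
      using C1_gradient_GDERIV[OF F] x by simp
    note D = D_x_grad[OF this] D_z_grad[OF this] D_p_grad[OF this]
    have PX: "grad_X X u y = ?P y" if "y \<in> \<Omega>" for y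
      using C1_gradient_GDERIV[OF u that] by (rule grad_X_eq_horizontal)
    have "vf_apply (X i) (\<lambda>y. D_p F (y, u y, grad_X X u y) $ i) x = X i x \<bullet> GQ i x" for i
      by (intro vf_apply_GDERIV GDERIV_transform_open[OF C1_gradient_GDERIV[OF Q x] \<open>open \<Omega>\<close> x])
         (simp add: PX)
    then have eq: "(\<Sum>i\<in>UNIV. X i x \<bullet> GQ i x) = D_z F ?w"
      using equation[OF x] by (simp add: div_X_def PX[OF x])
    define H where "H = (\<lambda>h. \<chi> j. h \<bullet> GG j x)"
    have H: "(G has_derivative H) (at x)"
      unfolding H_def using C1_gradient_GDERIV[OF G x]
      by (intro has_derivative_vecI) (simp add: gderiv_def)
    have sym: "h \<bullet> H k = k \<bullet> H h" for h k
      by (rule second_derivative_symmetric[OF \<open>open \<Omega>\<close> x _ H])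
         (use C1_gradient_GDERIV[OF u] in blast)
    have comm: "X i x \<bullet> TG x = T_field \<sigma> x \<bullet> PG i x + X i x \<bullet> G x" for i
      using homogeneous_commutator[OF _ _ H sym C1_gradient_GDERIV[OF P x] C1_gradient_GDERIV[OF T x]]
        X hom by blast
    let ?q = "real (\<Sum>k\<in>UNIV. \<sigma> k)" and ?Q = "D_p F ?w"
    have dot: "?Q \<bullet> ?P x = (\<Sum>i\<in>UNIV. ?Q $ i * (X i x \<bullet> G x))"
      by (simp add: inner_vec_def horizontal_def)
    have "divergence (pohozaev_field X \<sigma> a\<^sub>0 F u G) x =
        ?q * F ?w + T_field \<sigma> x \<bullet> (fst (\<Gamma> ?w) + fst (snd (\<Gamma> ?w)) *\<^sub>R G x
          + (\<Sum>i\<in>UNIV. snd (snd (\<Gamma> ?w)) $ i *\<^sub>R PG i x))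
        - (T_field \<sigma> x \<bullet> G x + a\<^sub>0 * u x) * (\<Sum>i\<in>UNIV. X i x \<bullet> GQ i x)
        - (\<Sum>i\<in>UNIV. ?Q $ i * (X i x \<bullet> (TG x + a\<^sub>0 *\<^sub>R G x)))"
      unfolding pohozaev_field_def[abs_def]
      by (rule pohozaev_field_divergence[OF X hom \<sigma> f s Q x])
    also have "T_field \<sigma> x \<bullet> (fst (\<Gamma> ?w) + fst (snd (\<Gamma> ?w)) *\<^sub>R G x
          + (\<Sum>i\<in>UNIV. snd (snd (\<Gamma> ?w)) $ i *\<^sub>R PG i x))
        = (\<Sum>i\<in>UNIV. real (\<sigma> i) * x $ i * D_x i F ?w) + D_z F ?w * (T_field \<sigma> x \<bullet> G x)
          + (\<Sum>i\<in>UNIV. ?Q $ i * (T_field \<sigma> x \<bullet> PG i x))"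
      by (simp add: D inner_add_right inner_sum_right inner_vec_def[of _ "fst _"] T_field_def[of \<sigma> x])
    also have "(\<Sum>i\<in>UNIV. ?Q $ i * (X i x \<bullet> (TG x + a\<^sub>0 *\<^sub>R G x)))
        = (\<Sum>i\<in>UNIV. ?Q $ i * (T_field \<sigma> x \<bullet> PG i x)) + (a\<^sub>0 + 1) * (?Q \<bullet> ?P x)"
      unfolding dot sum_distrib_left sum.distrib[symmetric]
      by (intro sum.cong refl) (simp add: inner_add_right comm algebra_simps)
    finally show ?thesis
      unfolding eq structure_expr_def by (simp add: algebra_simps)
  qed
qed

section \<open>Flux through the boundary and conclusion\<close>

text \<open>On the boundary the gradient of \<open>u\<close> is normal, so that the flux density factorises.\<close>

lemma pohozaev_boundary_flux:
  fixes X :: "'m::finite \<Rightarrow> 'n::finite vfield"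
  assumes "u x = 0" and "G x = c *\<^sub>R \<nu>"
  shows "pohozaev_field X \<sigma> a\<^sub>0 F u G x \<bullet> \<nu> = (T_field \<sigma> x \<bullet> \<nu>) *
    (F (x, 0, horizontal X G x) - D_p F (x, 0, horizontal X G x) \<bullet> horizontal X G x)"
proof -
  let ?P = "horizontal X G x" and ?Q = "D_p F (x, 0, horizontal X G x)"
  have "?Q \<bullet> ?P = (\<Sum>i\<in>UNIV. ?Q $ i * (c * (X i x \<bullet> \<nu>)))"
    using assms(2) by (simp add: inner_vec_def[of _ ?P]) (simp add: horizontal_def)
  also have "\<dots> = c * ((\<Sum>i\<in>UNIV. ?Q $ i *\<^sub>R X i x) \<bullet> \<nu>)"
    by (simp add: inner_sum_left sum_distrib_left mult_ac)
  finally show ?thesis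
    using assms by (simp add: pohozaev_field_def inner_diff_left algebra_simps)
qed

lemma continuous_nonneg_integral_nonpos_imp_0:
  fixes g :: "'a::euclidean_space \<Rightarrow> real"
  assumes "open S" "bounded S" and cont: "continuous_on (closure S) g"
    and nonneg: "\<And>x. x \<in> S \<Longrightarrow> 0 \<le> g x" and int: "(LINT x:S|lborel. g x) \<le> 0"
    and "x \<in> S"
  shows "g x = 0"
proof -
  have "set_integrable lborel (closure S) g"
    unfolding set_integrable_def
    using \<open>bounded S\<close> by (intro borel_integrable_compact cont) simp
  then have "set_integrable lborel S g"
    by (rule set_integrable_subset) (use \<open>open S\<close> closure_subset in auto)
  then have i: "integrable lborel (\<lambda>x. indicator S x *\<^sub>R g x)"
    by (simp add: set_integrable_def)
  have nn: "AE x in lborel. 0 \<le> indicator S x *\<^sub>R g x"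
    using nonneg by (auto simp: indicator_def)
  have "(\<integral>x. indicator S x *\<^sub>R g x \<partial>lborel) = 0"
    using int integral_nonneg_AE[OF nn] by (simp add: set_lebesgue_integral_def)
  then have AE: "AE x in lborel. indicator S x *\<^sub>R g x = 0"
    using integral_nonneg_eq_0_iff_AE[OF i nn] by simp
  define N where "N = {x \<in> S. g x \<in> {0<..}}"
  have "continuous_on S g" using cont closure_subset continuous_on_subset by blast
  then have "open N"
    using \<open>open S\<close> continuous_open_preimage[of S g "{0<..}"]
    by (simp add: N_def vimage_def Int_def)
  have "{x \<in> space lborel. \<not> x \<notin> N} = N" by (simp add: N_def)
  moreover have "AE x in lborel. x \<notin> N"
    using AE by eventually_elim (auto simp: N_def)
  ultimately have "N \<in> null_sets lborel"
    using AE_iff_null[of lborel "\<lambda>x. x \<notin> N"] \<open>open N\<close> by simp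
  then have "negligible N"
    unfolding negligible_iff_null_sets by (rule null_sets_completionI)
  then have "N = {}" using open_not_negligible[OF \<open>open N\<close>] by blast
  then have "\<not> 0 < g x" using \<open>x \<in> S\<close> by (auto simp: N_def)
  then show ?thesis using nonneg[OF \<open>x \<in> S\<close>] by simp
qed

theorem theorem3p7:
  fixes X :: "'m::finite \<Rightarrow> 'n::{finite,linorder} vfield"
    and \<sigma> :: "'n \<Rightarrow> nat"
    and \<Omega> :: "(real, 'n) vec set"
    and F :: "(real, 'n) vec \<times> real \<times> (real, 'm) vec \<Rightarrow> real"
    and a\<^sub>0 :: real
    and u :: "(real, 'n) vec \<Rightarrow> real"
  assumes smooth_X: "\<forall>i. smooth_vf (X i)"
    and independent: "vf_independent X"
    and exponents: "\<sigma> (Min UNIV) = 1" "mono \<sigma>"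
    and H1: "\<forall>i. homogeneous_deg1 \<sigma> (X i)"
    and H2: "dim {Y 0 | Y. Y \<in> Lie X} = CARD('n)"
    and \<Omega>: "open \<Omega>" "bounded \<Omega>" "connected \<Omega>"
    and regular: "regular_for_divergence_theorem \<Omega>"
    and star: "star_shaped \<sigma> \<Omega>"
    and P1: "\<exists>W. open W \<and> closure (\<Omega> \<times> UNIV) \<subseteq> W \<and> Ck_on 1 F W"
    and P2: "\<forall>i. Ck_closure 1 (\<lambda>w. D_p F w $ i) (\<Omega> \<times> UNIV)"
    and i: "\<forall>x\<in>frontier \<Omega>. \<forall>p. F (x, 0, p) - D_p F (x, 0, p) \<bullet> p \<le> 0"
    and ii: "\<forall>x\<in>\<Omega>. \<forall>z p. structure_expr \<sigma> a\<^sub>0 F x z p \<ge> 0"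
    and iii: "\<forall>x\<in>\<Omega>. \<forall>z p. structure_expr \<sigma> a\<^sub>0 F x z p = 0 \<longrightarrow> z = 0 \<or> p = 0"
    and u_C2: "Ck_closure 2 u \<Omega>"
    and equation: "\<forall>x\<in>\<Omega>. div_X X (\<lambda>y. D_p F (y, u y, grad_X X u y)) x
                          + D_z F (x, u x, grad_X X u x) = 0"
    and boundary: "\<forall>x\<in>frontier \<Omega>. u x = 0"
  shows "\<forall>x\<in>\<Omega>. u x = 0"
proof -
  have \<sigma>: "1 \<le> \<sigma> j" for j
    using monoD[OF \<open>mono \<sigma>\<close>, of "Min UNIV" j] exponents(1) by simp
  have open_prod: "open (\<Omega> \<times> (UNIV :: (real \<times> ((real, 'm) vec)) set))"
    by (intro open_Times \<Omega>(1) open_UNIV)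
  obtain G where u_cont: "continuous_on (closure \<Omega>) u"
    and uG: "\<And>x. x \<in> \<Omega> \<Longrightarrow> GDERIV u x :> G x"
    and G_C1: "\<And>b. b \<in> Basis \<Longrightarrow> Ck_closure 1 (\<lambda>x. b \<bullet> G x) \<Omega>"
    using Ck_closure_Suc_gradient[OF \<Omega>(1), of 1 u] u_C2 by (auto simp: numeral_2_eq_2)
  have "\<exists>g. C1_gradient \<Omega> (\<lambda>x. G x $ j) g" for j
    using Ck_closure_1_gradient[OF \<Omega>(1) G_C1[of "axis j 1"]]
    by (auto simp: inner_axis' axis_in_Basis_iff)
  then obtain GG where GG: "\<And>j. C1_gradient \<Omega> (\<lambda>x. G x $ j) (GG j)" by metis
  have "continuous_on (closure \<Omega>) (\<lambda>x. \<chi> j. G x $ j)"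
    by (intro continuous_on_vec_lambda C1_gradient_continuous[OF GG])
  then have G_cont: "continuous_on (closure \<Omega>) G" by simp
  have u: "C1_gradient \<Omega> u G"
    using u_cont G_cont uG by (simp add: C1_gradient_def)
  obtain W where W: "open W" "closure (\<Omega> \<times> UNIV) \<subseteq> W" "Ck_on 1 F W"
    using P1 by blast
  have F: "C1_gradient (\<Omega> \<times> UNIV) F (grad F)"
    using W by (intro C1_gradient_Ck_on)
  have "\<exists>g. C1_gradient (\<Omega> \<times> UNIV) (\<lambda>w. D_p F w $ i) g" for i
    using Ck_closure_1_gradient[OF open_prod] P2 by blast
  then obtain \<Gamma> where F\<^sub>p: "\<And>i. C1_gradient (\<Omega> \<times> UNIV) (\<lambda>w. D_p F w $ i) (\<Gamma> i)" by metis

  let ?P = "horizontal X G" and ?V = "pohozaev_field X \<sigma> a\<^sub>0 F u G"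
  let ?s = "\<lambda>x. structure_expr \<sigma> a\<^sub>0 F x (u x) (?P x)"
  have eq: "div_X X (\<lambda>y. D_p F (y, u y, grad_X X u y)) x + D_z F (x, u x, grad_X X u x) = 0"
    if "x \<in> \<Omega>" for x
    using equation that by blast
  note identity = pohozaev_identity[where X = X and \<sigma> = \<sigma> and \<Omega> = \<Omega> and u = u and G = G and GG = GG
      and F = F and \<Gamma> = "grad F" and \<Gamma>\<^sub>p = \<Gamma> and a\<^sub>0 = a\<^sub>0]
  have V_C1: "Ck_closure 1 (\<lambda>x. ?V x $ j) \<Omega>" for j
    by (rule identity(1)) (fact smooth_X H1 \<sigma> \<Omega>(1) u GG F F\<^sub>p eq)+
  have V_div: "divergence ?V x = ?s x" if "x \<in> \<Omega>" for x
    by (rule identity(2)) (fact smooth_X H1 \<sigma> \<Omega>(1) u GG F F\<^sub>p eq that)+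

  obtain \<nu> where normal: "AE x in hausdorff_measure (CARD('n) - 1).
      x \<in> frontier \<Omega> \<longrightarrow> outward_unit_normal \<Omega> x (\<nu> x)"
    and divergence_theorem: "\<And>V :: (real, 'n) vec \<Rightarrow> (real, 'n) vec. (\<forall>j. Ck_closure 1 (\<lambda>x. V x $ j) \<Omega>) \<Longrightarrow>
      (LINT x:\<Omega>|lborel. divergence V x) =
      (LINT x:frontier \<Omega>|hausdorff_measure (CARD('n) - 1). V x \<bullet> \<nu> x)"
    using regular unfolding regular_for_divergence_theorem_def by blast
  have flux: "?V x \<bullet> \<nu> x \<le> 0" if x: "x \<in> frontier \<Omega>" and n: "outward_unit_normal \<Omega> x (\<nu> x)" for x
  proof -
    have "G x = (\<nu> x \<bullet> G x) *\<^sub>R \<nu> x"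
      using boundary by (intro boundary_gradient_normal[OF \<Omega>(1) n u_cont uG G_cont]) auto
    then have "?V x \<bullet> \<nu> x = (T_field \<sigma> x \<bullet> \<nu> x) * (F (x, 0, ?P x) - D_p F (x, 0, ?P x) \<bullet> ?P x)"
      using boundary x by (intro pohozaev_boundary_flux) auto
    also have "\<dots> \<le> 0"
      using star i x n by (intro mult_nonneg_nonpos) (auto simp: star_shaped_def)
    finally show ?thesis .
  qed
  \<comment> \<open>\<open>\<nu>\<close> is the outward normal almost everywhere only, which is enough for the sign of the integral\<close>
  have "0 \<le> (LINT x|hausdorff_measure (CARD('n) - 1). - (indicator (frontier \<Omega>) x *\<^sub>R (?V x \<bullet> \<nu> x)))"
    by (rule integral_nonneg_AE) (use normal in eventually_elim, use flux in \<open>auto simp: indicator_def\<close>)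
  then have "(LINT x:frontier \<Omega>|hausdorff_measure (CARD('n) - 1). ?V x \<bullet> \<nu> x) \<le> 0"
    by (simp add: set_lebesgue_integral_def)
  then have "(LINT x:\<Omega>|lborel. divergence ?V x) \<le> 0"
    using divergence_theorem[of ?V] V_C1 by simp
  also have "(LINT x:\<Omega>|lborel. divergence ?V x) = (LINT x:\<Omega>|lborel. ?s x)"
    using \<Omega>(1) V_div by (intro set_lebesgue_integral_cong) auto
  finally have int: "(LINT x:\<Omega>|lborel. ?s x) \<le> 0" .

  have P_cont: "continuous_on (closure \<Omega>) ?P"
    unfolding horizontal_def[abs_def]
    using smooth_X by (intro continuous_on_vec_lambda continuous_on_inner smooth_vf_continuous G_cont) auto
  then have graph: "continuous_on (closure \<Omega>) (\<lambda>x. (x, u x, ?P x))"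
    by (intro continuous_on_Pair continuous_on_id u_cont)
  have along_graph: "continuous_on (closure \<Omega>) (\<lambda>x. \<Psi> (x, u x, ?P x))"
    if "continuous_on W \<Psi>" for \<Psi> :: "((real, 'n) vec) \<times> real \<times> ((real, 'm) vec) \<Rightarrow> real"
    using that graph by (rule continuous_on_compose2) (use W(2) in \<open>auto simp: closure_Times\<close>)
  have partials: "continuous_on (closure \<Omega>) (\<lambda>x. partial_deriv b F (x, u x, ?P x))" if "b \<in> Basis" for b
    using W(3) that by (intro along_graph) simp
  have F_cont: "continuous_on (closure \<Omega>) (\<lambda>x. F (x, u x, ?P x))"
    using Ck_on_Suc_imp[of 0 F W] W(3) by (intro along_graph) simp
  have D_x_cont: "continuous_on (closure \<Omega>) (\<lambda>x. D_x k F (x, u x, ?P x))" for k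
    unfolding D_x_def by (rule partials) (auto simp: Basis_prod_def axis_in_Basis_iff zero_prod_def)
  have D_z_cont: "continuous_on (closure \<Omega>) (\<lambda>x. D_z F (x, u x, ?P x))"
    unfolding D_z_def by (rule partials) (simp add: Basis_prod_def)
  have D_p_cont: "continuous_on (closure \<Omega>) (\<lambda>x. D_p F (x, u x, ?P x))"
    unfolding D_p_def
    by (intro continuous_on_vec_lambda partials) (simp add: Basis_prod_def axis_in_Basis_iff)
  have s_cont: "continuous_on (closure \<Omega>) ?s"
    unfolding structure_expr_def
    by (intro continuous_on_add continuous_on_diff continuous_on_mult continuous_on_sum
        continuous_on_inner continuous_on_const continuous_on_component continuous_on_id
        F_cont D_x_cont D_z_cont D_p_cont P_cont u_cont)
  have s0: "?s x = 0" if "x \<in> \<Omega>" for x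
    using ii by (intro continuous_nonneg_integral_nonpos_imp_0[OF \<Omega>(1,2) s_cont _ int that]) auto
  \<comment> \<open>passing to \<open>u\<^sup>2\<close> turns the alternative in (iii) into one equation, valid at every point\<close>
  have X_ann: "X k x \<bullet> ((2 * u x) *\<^sub>R G x) = 0" if "x \<in> \<Omega>" for k x
  proof -
    have "u x = 0 \<or> ?P x = 0" using iii s0[OF that] that by blast
    then have "u x = 0 \<or> ?P x $ k = 0" by auto
    then show ?thesis by (auto simp: horizontal_def)
  qed

  define H where "H = (\<lambda>x h. \<chi> j. h \<bullet> GG j x)"
  have H: "(G has_derivative H x) (at x)" if "x \<in> \<Omega>" for x
    unfolding H_def using C1_gradient_GDERIV[OF GG that]
    by (intro has_derivative_vecI) (simp add: gderiv_def)
  have u2: "GDERIV (\<lambda>x. (u x)\<^sup>2) x :> (2 * u x) *\<^sub>R G x" if "x \<in> \<Omega>" for x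
  proof -
    have "u x *\<^sub>R G x + u x *\<^sub>R G x = (2 * u x) *\<^sub>R G x"
      by (simp only: mult_2 scaleR_left_distrib)
    then show ?thesis
      using GDERIV_mult[OF uG[OF that] uG[OF that]] by (simp only: power2_eq_square)
  qed
  have u2': "((\<lambda>x. (2 * u x) *\<^sub>R G x) has_derivative
      (\<lambda>h. (2 * u x) *\<^sub>R H x h + (2 * (h \<bullet> G x)) *\<^sub>R G x)) (at x)" if "x \<in> \<Omega>" for x
    using uG[OF that] H[OF that] unfolding gderiv_def
    by (auto intro!: derivative_eq_intros)
  have u2_grad_0: "(2 * u x) *\<^sub>R G x = 0" if "x \<in> \<Omega>" for x
  proof (rule homogeneous_family_annihilates_imp_grad_0[where X = X and \<sigma> = \<sigma> and S = \<Omega> and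
        w = "\<lambda>x. (u x)\<^sup>2" and g = "\<lambda>x. (2 * u x) *\<^sub>R G x"])
    show "\<forall>x\<in>\<Omega>. GDERIV (\<lambda>x. (u x)\<^sup>2) x :> (2 * u x) *\<^sub>R G x" using u2 by blast
  qed (fact smooth_X H1 \<sigma> H2 \<Omega>(1) u2' X_ann that)+
  have "((\<lambda>x. (u x)\<^sup>2) has_derivative (\<lambda>h. 0)) (at x within \<Omega>)" if "x \<in> \<Omega>" for x
    using u2[OF that] unfolding u2_grad_0[OF that] by (simp add: gderiv_def has_derivative_at_withinI)
  moreover have u2_cont: "continuous_on (closure \<Omega>) (\<lambda>x. (u x)\<^sup>2)"
    by (intro continuous_intros u_cont)
  ultimately have "(\<lambda>x. (u x)\<^sup>2) constant_on \<Omega>"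
    using \<Omega> continuous_on_subset[OF u2_cont closure_subset]
    by (intro has_derivative_zero_connected_constant_on[of _ "{}"]) auto
  then obtain c where c: "\<And>x. x \<in> \<Omega> \<Longrightarrow> (u x)\<^sup>2 = c"
    unfolding constant_on_def by blast

  have "\<Omega> \<noteq> {}" using star by (simp add: star_shaped_def)
  moreover have "\<Omega> \<noteq> UNIV" using \<Omega>(2) not_bounded_UNIV by metis
  ultimately obtain b where b: "b \<in> frontier \<Omega>"
    using frontier_not_empty by blast
  then have "(u b)\<^sup>2 = c"
    using continuous_constant_on_closure[OF u2_cont c] by (simp add: frontier_def)
  moreover have "u b = 0" using boundary b by blast
  ultimately have "c = 0" by simp
  with c show ?thesis by simp
qed

end
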